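(* Consider the planted $k$-factor model with $p=\lambda/n$ and suppose $\lambda k\ge 1+\epsilon$ for some constant $\epsilon>0$. Then there exist constants $\epsilon'>0$ and $c>0$, depending only on $\epsilon$ and $k$, such that for every estimator $\widehat H$ and all sufficiently large $n$, $$\mathbb P\big(\ell(H^*,\widehat H)\ge\epsilon'\big)\ge 1-e^{-cn},$$ and consequently $\mathbb E[\ell(\widehat H,H^* )]\ge\epsilon'/2$ for all sufficiently large $n$.
   Context: Planted $k$-factor model: fix an integer $k\ge1$ and $n$ with $kn$ even. A $k$-factor on $[n]$ is a $k$-regular simple graph with vertex set $[n]$, identified with its edge set; $\mathcal H$ is the set of all $k$-factors on $[n]$. Let $p=\lambda/n\in[0,1]$. Draw $H^*$ uniformly at random from $\mathcal H$ and, independently, $G_0\sim\mathcal G(n,p)$ (each of the $\binom n2$ vertex pairs is an edge independently with probability $p$). The observed graph is $G=G_0\cup H^*$. An estimator is a function $\widehat H=\widehat H(G)$ taking values in sets of edges of the complete graph on $[n]$. The reconstruction error is $\ell(H^*,\widehat H)=\ell(\widehat H,H^* )=|H^*\triangle\widehat H|/|H^*|$, where $|H^*|=kn/2$. *)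

theory Defs
  imports Complex_Main
begin

definition all_edges :: "nat \<Rightarrow> nat set set" where
  "all_edges n = {e. \<exists>u v. u < n \<and> v < n \<and> u \<noteq> v \<and> e = {u, v}}"

definition k_factors :: "nat \<Rightarrow> nat \<Rightarrow> nat set set set" where
  "k_factors k n = {H. H \<subseteq> all_edges n \<and> (\<forall>v<n. card {e \<in> H. v \<in> e} = k)}"

definition loss :: "nat set set \<Rightarrow> nat set set \<Rightarrow> real" where
  "loss H Hh = real (card ((H - Hh) \<union> (Hh - H))) / real (card H)"

definition gnp_prob :: "nat \<Rightarrow> real \<Rightarrow> nat set set \<Rightarrow> real" where
  "gnp_prob n p G0 = p ^ card G0 * (1 - p) ^ (card (all_edges n) - card G0)"

text \<open>Expectation of f(H*, G) where H* uniform on k-factors, G0 ~ G(n,p) independent,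
  G = G0 \<union> H*.\<close>
definition planted_expect ::
  "nat \<Rightarrow> nat \<Rightarrow> real \<Rightarrow> (nat set set \<Rightarrow> nat set set \<Rightarrow> real) \<Rightarrow> real" where
  "planted_expect k n p f =
     (\<Sum>H\<in>k_factors k n. \<Sum>G0\<in>Pow (all_edges n). gnp_prob n p G0 * f H (G0 \<union> H))
       / real (card (k_factors k n))"

definition prob_loss_ge ::
  "nat \<Rightarrow> nat \<Rightarrow> real \<Rightarrow> (nat set set \<Rightarrow> nat set set) \<Rightarrow> real \<Rightarrow> real" where
  "prob_loss_ge k n p est t =
     planted_expect k n p (\<lambda>H G. if loss H (est G) \<ge> t then 1 else 0)"

definition expected_loss ::
  "nat \<Rightarrow> nat \<Rightarrow> real \<Rightarrow> (nat set set \<Rightarrow> nat set set) \<Rightarrow> real" where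
  "expected_loss k n p est = planted_expect k n p (\<lambda>H G. loss H (est G))"

end

theory Submission
  imports Defs
begin

text \<open>Given \<open>G\<close>, the planted \<open>H\<close> is uniform over the k-factors contained in \<open>G\<close>. Two k-factors of \<open>G\<close>
  that are both close to the estimate differ by a small subset of \<open>G\<close>, so only \<open>exp (a n / 2)\<close> of them
  can be close, and it suffices that \<open>G\<close> contains \<open>exp (a n)\<close> k-factors outside an
  event of exponentially small probability.

  Call an edge from an \<open>H\<close>-neighbour of \<open>x\<close> to \<open>y\<close> a step from \<open>x\<close> to \<open>y\<close>. Each centre has about
  \<open>\<lambda> k > 1\<close> steps, so the depth-first search argument of Krivelevich and Sudakov finds,
  except with exponentially small probability, an alternating path of linear length. Pairs joining a late
  \<open>H\<close>-neighbour on the path to an early centre are still unexposed, and one of them closes the path to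
  a long alternating cycle. This remains true after deleting any set \<open>D\<close> of \<open>\<delta> n\<close>
  vertices, for \<open>\<delta>\<close> so small that a union bound over \<open>D\<close> is affordable. As a cycle of linear
  length avoids only an exponentially small fraction of the sets \<open>D\<close>, there are exponentially
  many such cycles.\<close>

section \<open>Bernoulli random subsets\<close>

text \<open>The mean of \<open>f G\<close> when each element of \<open>E\<close> enters
  \<open>G\<close> independently with probability \<open>p\<close>, kept as a finite sum. For
  \<open>E = all_edges n\<close> the weights are those of \<open>gnp_prob\<close>.\<close>

definition bexp :: "real \<Rightarrow> 'a set \<Rightarrow> ('a set \<Rightarrow> real) \<Rightarrow> real" where
  "bexp p E f = (\<Sum>G\<in>Pow E. p ^ card G * (1 - p) ^ (card E - card G) * f G)"

lemma bexp_empty [simp]: "bexp p {} f = f {}"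
  by (simp add: bexp_def)

text \<open>Conditioning on whether \<open>e\<close> is present. The inductions on \<open>E\<close>
  and the exploration, which exposes one pair at a time, rest on this identity.\<close>

lemma bexp_insert:
  assumes "finite E" "e \<notin> E"
  shows "bexp p (insert e E) f = p * bexp p E (\<lambda>G. f (insert e G)) + (1 - p) * bexp p E f"
proof -
  let ?g = "\<lambda>G. p ^ card G * (1 - p) ^ (card (insert e E) - card G) * f G"
  have inj: "inj_on (insert e) (Pow E)"
    using assms(2) by (auto simp: inj_on_def)
  have "bexp p (insert e E) f = sum ?g (Pow E) + sum ?g (insert e ` Pow E)"
    unfolding bexp_def Pow_insert
    using assms by (intro sum.union_disjoint) auto
  also have "sum ?g (insert e ` Pow E) = (\<Sum>G\<in>Pow E. ?g (insert e G))"
    using inj by (simp add: sum.reindex)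
  also have "\<dots> = p * bexp p E (\<lambda>G. f (insert e G))"
    unfolding bexp_def sum_distrib_left
  proof (rule sum.cong[OF refl])
    fix G assume "G \<in> Pow E"
    then have "finite G" "e \<notin> G" using assms by (auto intro: finite_subset)
    then show "?g (insert e G)
      = p * (p ^ card G * (1 - p) ^ (card E - card G) * f (insert e G))"
      using assms by simp
  qed
  also have "sum ?g (Pow E) = (1 - p) * bexp p E f"
    unfolding bexp_def sum_distrib_left
  proof (rule sum.cong[OF refl])
    fix G assume "G \<in> Pow E"
    then have "card G \<le> card E" using assms by (auto intro: card_mono)
    then show "?g G = (1 - p) * (p ^ card G * (1 - p) ^ (card E - card G) * f G)"
      using assms by (simp add: Suc_diff_le)
  qed
  finally show ?thesis by simp
qed

lemma bexp_add: "bexp p E (\<lambda>G. f G + g G) = bexp p E f + bexp p E g"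
  by (simp add: bexp_def distrib_left sum.distrib)

lemma bexp_cmult: "bexp p E (\<lambda>G. c * f G) = c * bexp p E f"
  by (simp add: bexp_def sum_distrib_left mult_ac)

lemma bexp_sum: "bexp p E (\<lambda>G. \<Sum>i\<in>I. f i G) = (\<Sum>i\<in>I. bexp p E (f i))"
  unfolding bexp_def sum_distrib_left by (rule sum.swap)

lemma bexp_cong: "(\<And>G. G \<subseteq> E \<Longrightarrow> f G = g G) \<Longrightarrow> bexp p E f = bexp p E g"
  unfolding bexp_def by (rule sum.cong) auto

lemma bexp_mono:
  assumes "0 \<le> p" "p \<le> 1" "\<And>G. G \<subseteq> E \<Longrightarrow> f G \<le> g G"
  shows "bexp p E f \<le> bexp p E g"
  unfolding bexp_def using assms by (intro sum_mono mult_left_mono) auto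

text \<open>The generating function of a binomial variable: \<open>x = 1\<close> gives total mass
  one, \<open>x = exp 1\<close> a Chernoff bound on the number of edges.\<close>

lemma bexp_power:
  assumes "finite E"
  shows "bexp p E (\<lambda>G. x ^ card G) = (1 - p + p * x) ^ card E"
  using assms
proof (induction E)
  case (insert e E)
  have "bexp p E (\<lambda>G. x ^ card (insert e G)) = bexp p E (\<lambda>G. x * x ^ card G)"
    using insert.hyps by (intro bexp_cong) (auto simp: finite_subset card_insert_if)
  then show ?case
    using insert by (simp add: bexp_insert bexp_cmult algebra_simps)
qed simp

lemma bexp_const:
  assumes "finite E"
  shows "bexp p E (\<lambda>G. c) = c"
  using bexp_power[OF assms, of p 1] bexp_cmult[of p E c "\<lambda>_. 1"] by simp

lemma bexp_disjoint:
  assumes "finite E" "C \<subseteq> E"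
  shows "bexp p E (\<lambda>G. of_bool (G \<inter> C = {})) = (1 - p) ^ card C"
  using assms
proof (induction E arbitrary: C)
  case (insert e E)
  show ?case
  proof (cases "e \<in> C")
    case True
    have fin: "finite C" using insert.prems insert.hyps by (auto intro: finite_subset)
    have "bexp p E (\<lambda>G. of_bool (G \<inter> C = {})) = bexp p E (\<lambda>G. of_bool (G \<inter> (C - {e}) = {}))"
      using insert.hyps by (intro bexp_cong arg_cong[where f = of_bool]) auto
    also have "\<dots> = (1 - p) ^ card (C - {e})"
      using insert.prems by (intro insert.IH) auto
    finally show ?thesis
      using True insert.hyps bexp_const[OF insert.hyps(1), of p 0] card_Suc_Diff1[OF fin True]
      by (simp add: bexp_insert flip: power_Suc)
  next
    case False
    then have "C \<subseteq> E" using insert.prems by auto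
    then show ?thesis
      using insert False by (simp add: bexp_insert algebra_simps)
  qed
qed simp

lemma bexp_Un:
  assumes "finite A" "finite B" "A \<inter> B = {}"
  shows "bexp p (A \<union> B) f = bexp p A (\<lambda>G1. bexp p B (\<lambda>G2. f (G1 \<union> G2)))"
  using assms
proof (induction A arbitrary: f)
  case (insert a A)
  then show ?case
    by (simp add: bexp_insert)
qed simp

text \<open>An element is missed by two independent random subsets with probability
  \<open>(1 - p) * (1 - q)\<close>, so their union has density \<open>p + q - p * q\<close>. This
  lets noise be added to a sparser model.\<close>

lemma bexp_union_independent:
  assumes "finite E"
  shows "bexp (p + q - p * q) E f = bexp q E (\<lambda>G2. bexp p E (\<lambda>G1. f (G1 \<union> G2)))"
  using assms
proof (induction E arbitrary: f)
  case (insert e E)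
  have *: "bexp q E (\<lambda>G2. bexp p (insert e E) (\<lambda>G1. g (G1 \<union> G2)))
     = p * bexp q E (\<lambda>G2. bexp p E (\<lambda>G1. g (insert e (G1 \<union> G2))))
       + (1 - p) * bexp q E (\<lambda>G2. bexp p E (\<lambda>G1. g (G1 \<union> G2)))" for g
    using insert.hyps by (simp add: bexp_insert bexp_add bexp_cmult)
  have "bexp q (insert e E) (\<lambda>G2. bexp p (insert e E) (\<lambda>G1. f (G1 \<union> G2)))
     = (p + q - p * q) * bexp q E (\<lambda>G2. bexp p E (\<lambda>G1. f (insert e (G1 \<union> G2))))
       + (1 - (p + q - p * q)) * bexp q E (\<lambda>G2. bexp p E (\<lambda>G1. f (G1 \<union> G2)))"
    unfolding bexp_insert[OF insert.hyps, of q] *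
    using *[of "\<lambda>G. f (insert e G)"] by (simp add: algebra_simps)
  then show ?case
    using insert.IH[of "\<lambda>G. f (insert e G)"] insert.IH[of f] insert.hyps
    by (simp add: bexp_insert)
qed simp

section \<open>Alternating switches in a regular graph\<close>

lemma all_edges_iff: "{u, v} \<in> all_edges n \<longleftrightarrow> u < n \<and> v < n \<and> u \<noteq> v"
  by (auto simp: all_edges_def doubleton_eq_iff)

lemma all_edges_subset: "all_edges n \<subseteq> (\<lambda>(u, v). {u, v}) ` ({..<n} \<times> {..<n})"
  by (auto simp: all_edges_def)

lemma finite_all_edges [simp]: "finite (all_edges n)"
  using all_edges_subset by (rule finite_subset) auto

lemma card_all_edges_le: "card (all_edges n) \<le> n * n"
  using card_mono[OF _ all_edges_subset, of n]
    card_image_le[of "{..<n} \<times> {..<n}" "\<lambda>(u, v). {u, v}"]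
  by (simp add: card_cartesian_product)

definition nbrs :: "nat set set \<Rightarrow> nat \<Rightarrow> nat set" where
  "nbrs H x = {y. {x, y} \<in> H}"

lemma nbrs_sym: "y \<in> nbrs H x \<longleftrightarrow> x \<in> nbrs H y"
  by (simp add: nbrs_def insert_commute)

lemma k_factors_subset: "H \<in> k_factors k n \<Longrightarrow> H \<subseteq> all_edges n"
  by (simp add: k_factors_def)

lemma finite_k_factors [simp]: "finite (k_factors k n)"
  by (rule finite_subset[of _ "Pow (all_edges n)"]) (auto simp: k_factors_def)

lemma nbrs_bounds:
  assumes "H \<in> k_factors k n" "y \<in> nbrs H x"
  shows "x < n" "y < n" "x \<noteq> y"
  using k_factors_subset[OF assms(1)] assms(2) all_edges_iff[of x y n] by (auto simp: nbrs_def)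

lemma finite_nbrs: "H \<in> k_factors k n \<Longrightarrow> finite (nbrs H x)"
  by (rule finite_subset[of _ "{..<n}"]) (auto dest: nbrs_bounds)

lemma card_nbrs:
  assumes "H \<in> k_factors k n" "x < n"
  shows "card (nbrs H x) = k"
proof -
  have "{e \<in> H. x \<in> e} = (\<lambda>y. {x, y}) ` nbrs H x"
  proof (intro equalityI subsetI)
    fix e assume e: "e \<in> {e \<in> H. x \<in> e}"
    then have "e \<in> all_edges n" using k_factors_subset[OF assms(1)] by auto
    then obtain y where "e = {x, y}" using e by (auto simp: all_edges_def)
    then show "e \<in> (\<lambda>y. {x, y}) ` nbrs H x" using e by (auto simp: nbrs_def)
  qed (auto simp: nbrs_def)
  moreover have "inj_on (\<lambda>y. {x, y}) (nbrs H x)"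
    by (auto simp: inj_on_def doubleton_eq_iff)
  ultimately have "card (nbrs H x) = card {e \<in> H. x \<in> e}"
    by (simp add: card_image)
  then show ?thesis
    using assms by (simp add: k_factors_def)
qed

text \<open>Each vertex \<open>u t\<close> or \<open>w t\<close> lies on exactly one removed and
  exactly one inserted edge, so all degrees survive. The permutation \<open>\<pi>\<close> is
  arbitrary here; a cyclic shift turns the switch into one along a single alternating cycle.\<close>

lemma alternating_switch:
  fixes u w :: "'i \<Rightarrow> nat"
  assumes H: "H \<in> k_factors k n"
    and inj: "inj_on u I" "inj_on w I" and disj: "u ` I \<inter> w ` I = {}"
    and fin: "finite I" and bij: "bij_betw \<pi> I I"
    and old: "\<And>t. t \<in> I \<Longrightarrow> {u t, w t} \<in> H"
    and new: "\<And>t. t \<in> I \<Longrightarrow> {w t, u (\<pi> t)} \<notin> H"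
  defines "A \<equiv> (\<lambda>t. {u t, w t}) ` I" and "B \<equiv> (\<lambda>t. {w t, u (\<pi> t)}) ` I"
  shows "H - A \<union> B \<in> k_factors k n"
    and "\<Union>(sym_diff H (H - A \<union> B)) = u ` I \<union> w ` I"
proof -
  have \<pi>: "\<pi> t \<in> I" if "t \<in> I" for t using bij that by (auto simp: bij_betw_def)
  have AH: "A \<subseteq> H" and BH: "B \<inter> H = {}" using old new by (auto simp: A_def B_def)
  have bounds: "u t < n" "w t < n" if "t \<in> I" for t
    using k_factors_subset[OF H] old[OF that] all_edges_iff[of "u t" "w t" n] by auto
  have ne: "u s \<noteq> w t" if "s \<in> I" "t \<in> I" for s t using disj that by blast
  have BE: "B \<subseteq> all_edges n"
  proof
    fix e assume "e \<in> B"
    then obtain t where t: "t \<in> I" "e = {w t, u (\<pi> t)}" by (auto simp: B_def)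
    then show "e \<in> all_edges n"
      using bounds(2)[of t] bounds(1)[of "\<pi> t"] \<pi>[of t] ne[of "\<pi> t" t]
      by (simp add: all_edges_iff)
  qed
  \<comment> \<open>The removed edges form a perfect matching of the touched vertices.\<close>
  have cardA: "card {e \<in> A. v \<in> e} = of_bool (v \<in> u ` I \<union> w ` I)" for v
  proof (cases "v \<in> u ` I \<union> w ` I")
    case True
    then obtain s where s: "s \<in> I" "v = u s \<or> v = w s" by blast
    have "{e \<in> A. v \<in> e} = {{u s, w s}}"
    proof -
      have "t = s" if "t \<in> I" "v \<in> {u t, w t}" for t
        using s that ne[of s t] ne[of t s] inj_onD[OF inj(1), of s t] inj_onD[OF inj(2), of s t]
        by auto
      then have "e = {u s, w s}" if "e \<in> A" "v \<in> e" for e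
        using that unfolding A_def by blast
      then show ?thesis using s unfolding A_def by blast
    qed
    then show ?thesis using True by simp
  next
    case False
    then have empty: "{e \<in> A. v \<in> e} = {}" by (auto simp: A_def)
    show ?thesis unfolding empty using False by simp
  qed
  \<comment> \<open>So do the inserted edges, because every vertex on the \<open>u\<close> side is
    \<open>u (\<pi> s)\<close> for exactly one \<open>s\<close>.\<close>
  have cardB: "card {e \<in> B. v \<in> e} = of_bool (v \<in> u ` I \<union> w ` I)" for v
  proof (cases "v \<in> u ` I \<union> w ` I")
    case True
    then have "v \<in> u ` \<pi> ` I \<union> w ` I" using bij by (simp add: bij_betw_def)
    then obtain s where s: "s \<in> I" "v = u (\<pi> s) \<or> v = w s" by blast
    have "{e \<in> B. v \<in> e} = {{w s, u (\<pi> s)}}"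
    proof -
      have "t = s" if "t \<in> I" "v \<in> {w t, u (\<pi> t)}" for t
        using s that ne[of "\<pi> s" t] ne[of "\<pi> t" s] \<pi>[of s] \<pi>[of t]
          inj_onD[OF inj(1), of "\<pi> s" "\<pi> t"] inj_onD[OF inj(2), of s t]
          inj_onD[OF bij_betw_imp_inj_on[OF bij], of s t]
        by auto
      then have "e = {w s, u (\<pi> s)}" if "e \<in> B" "v \<in> e" for e
        using that unfolding B_def by blast
      then show ?thesis using s unfolding B_def by blast
    qed
    then show ?thesis using True by simp
  next
    case False
    then have empty: "{e \<in> B. v \<in> e} = {}" using \<pi> by (auto simp: B_def)
    show ?thesis unfolding empty using False by simp
  qed
  have "card {e \<in> H - A \<union> B. v \<in> e} = k" if "v < n" for v
  proof -
    have finH: "finite H" using k_factors_subset[OF H] by (rule finite_subset) simp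
    have finA: "finite A" "finite B" using fin by (auto simp: A_def B_def)
    have "{e \<in> H - A \<union> B. v \<in> e} = ({e \<in> H. v \<in> e} - {e \<in> A. v \<in> e}) \<union> {e \<in> B. v \<in> e}"
      by auto
    also have "card \<dots> = card ({e \<in> H. v \<in> e} - {e \<in> A. v \<in> e}) + card {e \<in> B. v \<in> e}"
      using BH finA finH by (intro card_Un_disjoint) auto
    also have "card ({e \<in> H. v \<in> e} - {e \<in> A. v \<in> e})
        = card {e \<in> H. v \<in> e} - card {e \<in> A. v \<in> e}"
      using AH finA by (intro card_Diff_subset) auto
    finally have "card {e \<in> H - A \<union> B. v \<in> e}
        = card {e \<in> H. v \<in> e} - card {e \<in> A. v \<in> e} + card {e \<in> A. v \<in> e}"
      by (simp add: cardA cardB)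
    moreover have "card {e \<in> A. v \<in> e} \<le> card {e \<in> H. v \<in> e}"
      using AH finH by (intro card_mono) auto
    ultimately show ?thesis using H that by (simp add: k_factors_def)
  qed
  then show "H - A \<union> B \<in> k_factors k n"
    using BE k_factors_subset[OF H] by (auto simp: k_factors_def)
  have "sym_diff H (H - A \<union> B) = A \<union> B" using AH BH by auto
  moreover have "u ` \<pi> ` I = u ` I" using bij by (simp add: bij_betw_def)
  ultimately show "\<Union>(sym_diff H (H - A \<union> B)) = u ` I \<union> w ` I"
    by (auto simp: A_def B_def image_image)
qed

section \<open>Depth-first exploration\<close>

definition star :: "nat set set \<Rightarrow> nat \<Rightarrow> nat set" where
  "star H x = insert x (nbrs H x)"

text \<open>Disjoint stars force all centres and chosen neighbours on a path to be distinct
  vertices, so that closing the path gives a genuine cycle. The set \<open>D\<close> holds the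
  forbidden vertices.\<close>

definition separated :: "nat \<Rightarrow> nat set set \<Rightarrow> nat set \<Rightarrow> nat set \<Rightarrow> bool" where
  "separated n H D Z \<longleftrightarrow> Z \<subseteq> {..<n} \<and> (\<forall>x\<in>Z. star H x \<inter> D = {})
     \<and> (\<forall>x\<in>Z. \<forall>y\<in>Z. x \<noteq> y \<longrightarrow> star H x \<inter> star H y = {})"

definition free :: "nat \<Rightarrow> nat set set \<Rightarrow> nat set \<Rightarrow> nat set \<Rightarrow> nat set" where
  "free n H D Z = {x. x < n \<and> star H x \<inter> (D \<union> \<Union>(star H ` Z)) = {}}"

text \<open>Here \<open>G\<close> is the noise alone, so \<open>H\<close> is added back. The switch
  is measured in vertices because it is later counted against vertex sets \<open>D\<close> that it
  avoids.\<close>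

definition switchable :: "nat \<Rightarrow> nat \<Rightarrow> nat set set \<Rightarrow> nat set \<Rightarrow> nat \<Rightarrow> nat set set \<Rightarrow> bool" where
  "switchable k n H D m G \<longleftrightarrow> (\<exists>H'\<in>k_factors k n. H' \<subseteq> G \<union> H
     \<and> D \<inter> \<Union>(sym_diff H H') = {} \<and> m \<le> card (\<Union>(sym_diff H H')))"

definition port :: "nat set set \<Rightarrow> nat \<Rightarrow> nat" where
  "port H x = (SOME y. y \<in> nbrs H x)"

text \<open>The stack has its top first: indices below \<open>m\<close> are the latest centres,
  those from \<open>2 * m\<close> on the earliest. Any such pair therefore cuts out a cycle through
  more than \<open>m\<close> centres.\<close>

definition closing :: "nat set set \<Rightarrow> nat list \<Rightarrow> nat \<Rightarrow> nat set set" where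
  "closing H us m = (\<lambda>(j, i). {port H (us ! j), us ! i}) ` ({..<m} \<times> {2 * m..<3 * m})"

lemma separated_eq:
  "separated n H D Z \<Longrightarrow> x \<in> Z \<Longrightarrow> y \<in> Z \<Longrightarrow> a \<in> star H x \<Longrightarrow> a \<in> star H y \<Longrightarrow> x = y"
  unfolding separated_def by blast

lemma self_in_star: "x \<in> star H x"
  by (simp add: star_def)

lemma nbrs_in_star: "y \<in> nbrs H x \<Longrightarrow> y \<in> star H x"
  by (simp add: star_def)

lemma port_in_nbrs:
  assumes "H \<in> k_factors k n" "k \<ge> 1" "x < n"
  shows "port H x \<in> nbrs H x"
proof -
  have "nbrs H x \<noteq> {}" using card_nbrs[OF assms(1,3)] assms(2) by auto
  then show ?thesis unfolding port_def by (simp add: some_in_eq)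
qed

lemma card_star_le: "H \<in> k_factors k n \<Longrightarrow> x < n \<Longrightarrow> card (star H x) \<le> k + 1"
  using card_insert_le_m1[of "k + 1" "nbrs H x" x] card_nbrs[of H k n x]
  by (simp add: star_def)

section \<open>Turning a path into a switch\<close>

text \<open>A closing pair that is present joins the ends of the stretch from index \<open>i\<close>
  up to index \<open>j\<close> into an alternating cycle; switching along it drops one
  \<open>H\<close>-edge per centre and inserts the path edges and the closing pair.\<close>

lemma switchable_closing:
  assumes H: "H \<in> k_factors k n" and k: "k \<ge> 1" and m: "m \<ge> 1"
    and sep: "separated n H D (set us)" and us: "distinct us" "length us = 3 * m"
    and path: "\<And>t. Suc t < 3 * m \<Longrightarrow> \<exists>w\<in>nbrs H (us ! Suc t). {w, us ! t} \<in> G"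
    and close: "G \<inter> closing H us m \<noteq> {}"
  shows "switchable k n H D m G"
proof -
  obtain i j where j: "j < m" and i: "2 * m \<le> i" "i < 3 * m"
    and ij: "{port H (us ! j), us ! i} \<in> G"
    using close by (auto simp: closing_def)
  define I where "I = {j..i}"
  define u where "u t = us ! t" for t
  \<comment> \<open>At \<open>j\<close> the cycle leaves through the port; elsewhere
    \<open>w t\<close> is the neighbour that witnesses the path edge to the centre above.\<close>
  define w where "w t = (if t = j then port H (us ! j)
    else (SOME w. w \<in> nbrs H (us ! t) \<and> {w, us ! (t - 1)} \<in> G))" for t
  define \<pi> where "\<pi> t = (if t = j then i else t - 1)" for t
  have mem: "u t \<in> set us" if "t \<in> I" for t
    using that i us by (simp add: I_def u_def)
  have lt: "u t < n" if "t \<in> I" for t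
    using mem[OF that] sep by (auto simp: separated_def)
  have w: "w t \<in> nbrs H (u t) \<and> {w t, u (\<pi> t)} \<in> G" if t: "t \<in> I" for t
  proof (cases "t = j")
    case True
    then show ?thesis
      using port_in_nbrs[OF H k lt[OF t]] ij by (simp add: w_def u_def \<pi>_def)
  next
    case False
    then have t': "Suc (t - 1) = t" "t < 3 * m" using t i by (auto simp: I_def)
    have "\<exists>w. w \<in> nbrs H (us ! t) \<and> {w, us ! (t - 1)} \<in> G"
      using path[of "t - 1"] t' by auto
    then show ?thesis
      using False someI_ex[of "\<lambda>w. w \<in> nbrs H (us ! t) \<and> {w, us ! (t - 1)} \<in> G"]
      by (simp add: w_def u_def \<pi>_def)
  qed
  have bij: "bij_betw \<pi> I I"
    by (rule bij_betw_byWitness[where f' = "\<lambda>t. if t = i then j else Suc t"])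
      (use j i in \<open>auto simp: I_def \<pi>_def\<close>)
  have \<pi>: "\<pi> t \<in> I" "\<pi> t \<noteq> t" if "t \<in> I" for t
    using that j i by (auto simp: I_def \<pi>_def)
  have inj_u: "inj_on u I"
    using us i by (auto simp: inj_on_def u_def I_def nth_eq_iff_index_eq)
  have meet: "s = t" if "s \<in> I" "t \<in> I" "a \<in> star H (u s)" "a \<in> star H (u t)" for s t a
    using separated_eq[OF sep mem[OF that(1)] mem[OF that(2)] that(3,4)] inj_u that(1,2)
    by (auto dest: inj_onD)
  have w_star: "w t \<in> star H (u t)" if "t \<in> I" for t
    using w[OF that] by (simp add: nbrs_in_star)
  have inj_w: "inj_on w I"
    using meet w_star by (intro inj_onI) metis
  have disj: "u ` I \<inter> w ` I = {}"
  proof -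
    have "u s \<noteq> w t" if "s \<in> I" "t \<in> I" for s t
    proof
      assume eq: "u s = w t"
      then have "s = t" using meet[OF that, of "u s"] w_star[OF that(2)] self_in_star by metis
      then show False using eq w[OF that(2)] nbrs_bounds(3)[OF H, of "w t" "u t"] by auto
    qed
    then show ?thesis by auto
  qed
  have old: "{u t, w t} \<in> H" if "t \<in> I" for t
    using w[OF that] by (simp add: nbrs_def)
  \<comment> \<open>Were the new pair in \<open>H\<close>, then \<open>w t\<close> would lie in the
    stars of two different centres; \<open>\<pi> t\<close> differs from \<open>t\<close> because
    \<open>j < i\<close>.\<close>
  have new: "{w t, u (\<pi> t)} \<notin> H" if t: "t \<in> I" for t
  proof
    assume "{w t, u (\<pi> t)} \<in> H"
    then have "w t \<in> star H (u (\<pi> t))"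
      by (simp add: star_def nbrs_def insert_commute)
    then show False
      using meet[OF t \<pi>(1)[OF t] w_star[OF t]] \<pi>(2)[OF t] by simp
  qed
  have fin: "finite I" by (simp add: I_def)
  define H' where "H' = H - (\<lambda>t. {u t, w t}) ` I \<union> (\<lambda>t. {w t, u (\<pi> t)}) ` I"
  have H': "H' \<in> k_factors k n" "\<Union>(sym_diff H H') = u ` I \<union> w ` I"
    unfolding H'_def
    using alternating_switch[OF H inj_u inj_w disj fin bij old new] by blast+
  have "H' \<subseteq> G \<union> H" using w by (auto simp: H'_def)
  moreover have "D \<inter> \<Union>(sym_diff H H') = {}"
  proof -
    have "a \<notin> D" if "t \<in> I" "a \<in> star H (u t)" for a t
      using sep mem[OF that(1)] that(2) by (auto simp: separated_def)
    then show ?thesis unfolding H'(2) using w_star self_in_star by blast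
  qed
  moreover have "m \<le> card (\<Union>(sym_diff H H'))"
  proof -
    have "m \<le> card I" using j i by (simp add: I_def)
    also have "\<dots> = card (u ` I)" by (rule card_image[OF inj_u, symmetric])
    also have "\<dots> \<le> card (\<Union>(sym_diff H H'))"
      unfolding H'(2) using fin by (intro card_mono) auto
    finally show ?thesis .
  qed
  ultimately show ?thesis
    using H'(1) unfolding switchable_def by blast
qed

text \<open>Since the stars are disjoint, the pair determines both indices.\<close>

lemma card_closing:
  assumes H: "H \<in> k_factors k n" and k: "k \<ge> 1"
    and sep: "separated n H D (set us)" and us: "distinct us" "length us = 3 * m"
  shows "card (closing H us m) = m * m"
proof -
  have "inj_on (\<lambda>(j, i). {port H (us ! j), us ! i}) ({..<m} \<times> {2 * m..<3 * m})"
  proof (rule inj_onI, clarsimp)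
    fix j i j' i'
    assume b: "j < m" "2 * m \<le> i" "i < 3 * m" "j' < m" "2 * m \<le> i'" "i' < 3 * m"
      and eq: "{port H (us ! j), us ! i} = {port H (us ! j'), us ! i'}"
    have mem: "us ! t \<in> set us" if "t < 3 * m" for t using us that by simp
    have P: "port H (us ! t) \<in> star H (us ! t)" if "t < 3 * m" for t
      using port_in_nbrs[OF H k, of "us ! t"] mem[OF that] sep
      by (auto simp: separated_def intro: nbrs_in_star)
    have meet: "s = t" if "s < 3 * m" "t < 3 * m" "a \<in> star H (us ! s)" "a \<in> star H (us ! t)"
      for s t a
      using separated_eq[OF sep mem[OF that(1)] mem[OF that(2)] that(3,4)] us that(1,2)
      by (simp add: nth_eq_iff_index_eq)
    have "port H (us ! j) \<noteq> us ! i'"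
      using meet[of j i' "us ! i'"] P[of j] b by (auto simp: self_in_star)
    then have "port H (us ! j) = port H (us ! j')" "us ! i = us ! i'"
      using eq by (auto simp: doubleton_eq_iff)
    then show "j = j' \<and> i = i'"
      using meet[of j j' "port H (us ! j)"] P[of j] P[of j'] b us
      by (simp add: nth_eq_iff_index_eq)
  qed
  then show ?thesis
    by (simp add: closing_def card_image card_cartesian_product)
qed

text \<open>If the star of \<open>x\<close> meets the blocked set \<open>X\<close>, then by symmetry
  of adjacency \<open>x\<close> lies in the star of a vertex of \<open>X\<close>. Stars have at most
  \<open>k + 1\<close> vertices, which is used once to bound \<open>X\<close> and once to bound what
  it blocks.\<close>

lemma card_free_ge:
  assumes H: "H \<in> k_factors k n" and D: "finite D" "card D \<le> d"
    and Z: "Z \<subseteq> {..<n}" "card Z \<le> a"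
  shows "n - (k + 1) * (d + (k + 1) * a) \<le> card (free n H D Z)"
proof -
  define X where "X = D \<union> \<Union>(star H ` Z)"
  have finZ: "finite Z" using Z(1) by (rule finite_subset) simp
  have finstar: "finite (star H x)" for x by (simp add: star_def finite_nbrs[OF H])
  have finX: "finite X" using D finZ finstar by (simp add: X_def)
  have "card (\<Union>(star H ` Z)) \<le> (\<Sum>x\<in>Z. card (star H x))"
    by (rule card_UN_le[OF finZ])
  also have "\<dots> \<le> (\<Sum>x\<in>Z. k + 1)"
    using Z by (intro sum_mono card_star_le[OF H]) auto
  also have "\<dots> = (k + 1) * card Z" by (simp add: mult.commute)
  also have "\<dots> \<le> (k + 1) * a" using Z(2) by (rule mult_le_mono2)
  finally have "card X \<le> d + (k + 1) * a"
    unfolding X_def using card_Un_le[of D "\<Union>(star H ` Z)"] D(2) by linarith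
  have "{..<n} - free n H D Z \<subseteq> (\<Union>y\<in>X \<inter> {..<n}. star H y)"
  proof
    fix x assume "x \<in> {..<n} - free n H D Z"
    then have "x < n" "star H x \<inter> X \<noteq> {}" by (auto simp: free_def X_def)
    then obtain y where "y \<in> X" "y \<in> star H x" by auto
    then have "y < n" "x \<in> star H y"
      using \<open>x < n\<close> nbrs_bounds(2)[OF H] nbrs_sym[of x H y] by (auto simp: star_def)
    then show "x \<in> (\<Union>y\<in>X \<inter> {..<n}. star H y)" using \<open>y \<in> X\<close> by auto
  qed
  then have "card ({..<n} - free n H D Z) \<le> card (\<Union>y\<in>X \<inter> {..<n}. star H y)"
    using finX finstar by (intro card_mono) auto
  also have "\<dots> \<le> (\<Sum>y\<in>X \<inter> {..<n}. card (star H y))"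
    using finX by (intro card_UN_le) auto
  also have "\<dots> \<le> (\<Sum>y\<in>X \<inter> {..<n}. k + 1)"
    by (intro sum_mono card_star_le[OF H]) auto
  also have "\<dots> \<le> (k + 1) * card X"
    using mult_le_mono2[OF card_mono[OF finX, of "X \<inter> {..<n}"], of "k + 1"]
    by (simp add: mult.commute)
  also have "\<dots> \<le> (k + 1) * (d + (k + 1) * a)"
    using \<open>card X \<le> _\<close> by (rule mult_le_mono2)
  finally have "card ({..<n} - free n H D Z) \<le> (k + 1) * (d + (k + 1) * a)" .
  moreover have "free n H D Z \<subseteq> {..<n}" by (auto simp: free_def)
  then have "card ({..<n} - free n H D Z) = n - card (free n H D Z)"
    by (simp add: card_Diff_subset finite_subset)
  ultimately show ?thesis by linarith
qed

text \<open>A state of the exploration: \<open>S\<close> holds the finished centres, \<open>us\<close> is the stack with its top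
  first, \<open>R\<close> the vertex pairs exposed so far and \<open>K\<close> those found to be edges. A query
  at the top \<open>u\<close> exposes \<open>{w, x}\<close> with \<open>w\<close> an \<open>H\<close>-neighbour of \<open>u\<close> and \<open>x\<close> free;
  hence the neighbours of a centre are never queried against the centres below it.\<close>
definition explored :: "nat \<Rightarrow> nat set set \<Rightarrow> nat set \<Rightarrow> nat set \<Rightarrow> nat list
    \<Rightarrow> nat set set \<Rightarrow> nat set set \<Rightarrow> bool" where
  "explored n H D S us R K \<longleftrightarrow>
     separated n H D (S \<union> set us) \<and> distinct us \<and> S \<inter> set us = {} \<and>
     R \<subseteq> all_edges n \<and> K \<subseteq> R \<and>
     (\<forall>t. Suc t < length us \<longrightarrow> (\<exists>w\<in>nbrs H (us ! Suc t). {w, us ! t} \<in> K)) \<and>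
     (\<forall>s\<in>S. \<forall>w\<in>nbrs H s. \<forall>x\<in>free n H D (S \<union> set us). {w, x} \<in> R) \<and>
     (\<forall>j i. j < i \<longrightarrow> i < length us \<longrightarrow> (\<forall>w\<in>nbrs H (us ! j). {w, us ! i} \<notin> R)) \<and>
     (\<forall>e\<in>R. \<exists>z\<in>S \<union> set us. \<exists>w\<in>nbrs H z. w \<in> e)"

lemma exploredD:
  assumes "explored n H D S us R K"
  shows "separated n H D (S \<union> set us)" "distinct us" "S \<inter> set us = {}"
    "R \<subseteq> all_edges n" "K \<subseteq> R"
    "\<And>t. Suc t < length us \<Longrightarrow> \<exists>w\<in>nbrs H (us ! Suc t). {w, us ! t} \<in> K"
    "\<And>s w x. s \<in> S \<Longrightarrow> w \<in> nbrs H s \<Longrightarrow> x \<in> free n H D (S \<union> set us) \<Longrightarrow> {w, x} \<in> R"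
    "\<And>j i w. j < i \<Longrightarrow> i < length us \<Longrightarrow> w \<in> nbrs H (us ! j) \<Longrightarrow> {w, us ! i} \<notin> R"
    "\<And>e. e \<in> R \<Longrightarrow> \<exists>z\<in>S \<union> set us. \<exists>w\<in>nbrs H z. w \<in> e"
  using assms unfolding explored_def by simp_all

section \<open>Moves of the exploration\<close>

lemma free_insert_subset: "free n H D (insert x Z) \<subseteq> free n H D Z"
  by (auto simp: free_def)

lemma separated_insert:
  assumes "separated n H D Z" "x \<in> free n H D Z"
  shows "separated n H D (insert x Z)"
proof -
  have "x < n" "star H x \<inter> D = {}" and x: "\<And>y. y \<in> Z \<Longrightarrow> star H x \<inter> star H y = {}"
    using assms(2) by (auto simp: free_def)
  moreover have "\<And>y. y \<in> Z \<Longrightarrow> star H y \<inter> star H x = {}" using x by blast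
  ultimately show ?thesis
    using assms(1) unfolding separated_def by simp
qed

lemma free_notin:
  assumes "x \<in> free n H D Z" "z \<in> Z" "a \<in> star H x"
  shows "a \<notin> star H z"
  using assms by (auto simp: free_def)

lemma centre_not_nbr:
  assumes "H \<in> k_factors k n" "separated n H D Z" "x \<in> Z" "z \<in> Z"
  shows "x \<notin> nbrs H z"
proof
  assume x: "x \<in> nbrs H z"
  then have "z = x" using separated_eq[OF assms(2,4,3), of x] by (simp add: star_def)
  then show False using x nbrs_bounds(3)[OF assms(1)] by blast
qed

text \<open>The conditions on the path are vacuous for a single centre, and obligations on finished
  centres only weaken as the free set shrinks.\<close>

lemma explored_restart:
  assumes "explored n H D S [] R K" "x \<in> free n H D S"
  shows "explored n H D S [x] R K"
proof -
  note E = exploredD[OF assms(1)]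
  have "x \<notin> S" using free_notin[OF assms(2), of x x] self_in_star by auto
  moreover have "separated n H D (insert x S)"
    using separated_insert[OF _ assms(2)] E(1) by simp
  moreover have "{w, y} \<in> R" if "s \<in> S" "w \<in> nbrs H s" "y \<in> free n H D (insert x S)" for s w y
    using E(7) that free_insert_subset[of n H D x S] by auto
  moreover have "\<exists>z\<in>insert x S. \<exists>w\<in>nbrs H z. w \<in> e" if "e \<in> R" for e
    using E(9)[OF that] by auto
  ultimately show ?thesis
    unfolding explored_def using E(4,5) by simp
qed

text \<open>The top is finished once its neighbours have been queried against every free vertex. The
  set of used centres, and with it the free set, does not change.\<close>

lemma explored_pop:
  assumes "explored n H D S (u # us) R K"
    and "\<And>w x. w \<in> nbrs H u \<Longrightarrow> x \<in> free n H D (S \<union> set (u # us)) \<Longrightarrow> {w, x} \<in> R"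
  shows "explored n H D (insert u S) us R K"
proof -
  note E = exploredD[OF assms(1)]
  have Z: "insert u S \<union> set us = S \<union> set (u # us)" by auto
  have "\<exists>w\<in>nbrs H (us ! Suc t). {w, us ! t} \<in> K" if "Suc t < length us" for t
    using E(6)[of "Suc t"] that by simp
  moreover have "{w, us ! i} \<notin> R" if "j < i" "i < length us" "w \<in> nbrs H (us ! j)" for j i w
    using E(8)[of "Suc j" "Suc i"] that by simp
  moreover have "{w, x} \<in> R"
    if "s \<in> insert u S" "w \<in> nbrs H s" "x \<in> free n H D (S \<union> set (u # us))" for s w x
    using E(7)[of s] assms(2) that by auto
  ultimately show ?thesis
    unfolding explored_def Z using E(1-5,9) by auto
qed

text \<open>A negative answer only enlarges \<open>R\<close>; a positive one also pushes
  \<open>x\<close>. As \<open>x\<close> lies in no star of a used centre, the exposed pair is none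
  of the pairs reserved for closing the path.\<close>

lemma explored_query:
  assumes H: "H \<in> k_factors k n"
    and "explored n H D S (u # us) R K" "w \<in> nbrs H u" "x \<in> free n H D (S \<union> set (u # us))"
  shows "{w, x} \<in> all_edges n"
    and "explored n H D S (u # us) (insert {w, x} R) K"
    and "explored n H D S (x # u # us) (insert {w, x} R) (insert {w, x} K)"
    and "x \<notin> S \<union> set (u # us)"
proof -
  note E = exploredD[OF assms(2)]
  define Z where "Z = S \<union> set (u # us)"
  have uZ: "u \<in> Z" by (simp add: Z_def)
  note x = assms(4)[folded Z_def]
  have xZ: "x \<notin> star H z" if "z \<in> Z" for z
    using free_notin[OF x that self_in_star] .
  then show xZ': "x \<notin> S \<union> set (u # us)" using self_in_star unfolding Z_def by metis
  have "x < n" using x by (auto simp: free_def)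
  moreover have "w < n" using nbrs_bounds(2)[OF H assms(3)] .
  moreover have "w \<noteq> x" using xZ[OF uZ] assms(3) nbrs_in_star by metis
  ultimately show e: "{w, x} \<in> all_edges n" by (simp add: all_edges_iff)
  have cov: "\<exists>z\<in>Z. \<exists>v\<in>nbrs H z. v \<in> e" if "e \<in> insert {w, x} R" for e
    using that E(9)[of e] assms(3) uZ unfolding Z_def by auto
  have old: "{v, (u # us) ! i} \<notin> insert {w, x} R"
    if "j < i" "i < length (u # us)" "v \<in> nbrs H ((u # us) ! j)" for j i v
  proof -
    have "(u # us) ! i \<in> Z" "(u # us) ! j \<in> Z" using that by (auto simp: Z_def nth_Cons')
    then have "x \<noteq> v" "x \<noteq> (u # us) ! i"
      using xZ that(3) nbrs_in_star self_in_star by metis+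
    then have "{v, (u # us) ! i} \<noteq> {w, x}" by auto
    then show ?thesis using E(8)[OF that] by simp
  qed
  have done_R: "{v, y} \<in> insert {w, x} R" if "s \<in> S" "v \<in> nbrs H s" "y \<in> free n H D Z" for s v y
    using E(7)[of s v y] that by (simp add: Z_def)
  show "explored n H D S (u # us) (insert {w, x} R) K"
    unfolding explored_def Z_def[symmetric]
  proof (intro conjI)
    show "insert {w, x} R \<subseteq> all_edges n" "K \<subseteq> insert {w, x} R" using e E(4,5) by auto
    show "\<forall>t. Suc t < length (u # us) \<longrightarrow>
        (\<exists>v\<in>nbrs H ((u # us) ! Suc t). {v, (u # us) ! t} \<in> K)"
      using E(6) by blast
    show "\<forall>s\<in>S. \<forall>v\<in>nbrs H s. \<forall>y\<in>free n H D Z. {v, y} \<in> insert {w, x} R"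
      using done_R by blast
    show "\<forall>j i. j < i \<longrightarrow> i < length (u # us) \<longrightarrow>
        (\<forall>v\<in>nbrs H ((u # us) ! j). {v, (u # us) ! i} \<notin> insert {w, x} R)"
      using old by blast
    show "\<forall>e\<in>insert {w, x} R. \<exists>z\<in>Z. \<exists>v\<in>nbrs H z. v \<in> e"
      using cov by blast
  qed (rule E(1-3)[folded Z_def])+
  have sep: "separated n H D (insert x Z)"
    using separated_insert[OF E(1)[folded Z_def] x] .
  have new: "{v, (x # u # us) ! i} \<notin> insert {w, x} R"
    if "j < i" "i < length (x # u # us)" "v \<in> nbrs H ((x # u # us) ! j)" for j i v
  proof (cases j)
    case (Suc j')
    then show ?thesis using old[of j' "i - 1" v] that by (cases i) auto
  next
    case 0
    then have v: "v \<in> nbrs H x" using that by simp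
    obtain i' where i': "i = Suc i'" using \<open>j < i\<close> by (cases i) auto
    then have y: "(u # us) ! i' \<in> Z" using that by (auto simp: Z_def nth_Cons')
    have "v \<noteq> x" using nbrs_bounds(3)[OF H v] by simp
    moreover have "(u # us) ! i' \<noteq> x" using xZ[OF y] self_in_star by metis
    ultimately have "{v, (u # us) ! i'} \<noteq> {w, x}" by auto
    \<comment> \<open>An exposed pair contains a neighbour of some used centre \<open>z\<close>. It
      cannot be \<open>v\<close>, since the star of \<open>x\<close> is fresh, nor the old centre,
      since no centre is a neighbour of another.\<close>
    moreover have "{v, (u # us) ! i'} \<notin> R"
    proof
      assume "{v, (u # us) ! i'} \<in> R"
      then obtain z p where z: "z \<in> Z" "p \<in> nbrs H z" "p = v \<or> p = (u # us) ! i'"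
        using E(9)[of "{v, (u # us) ! i'}"] unfolding Z_def by blast
      have "v \<notin> star H z" using free_notin[OF x z(1) nbrs_in_star[OF v]] .
      moreover have "(u # us) ! i' \<notin> nbrs H z"
        using centre_not_nbr[OF H E(1)[folded Z_def] y z(1)] .
      ultimately show False using z(2,3) nbrs_in_star by metis
    qed
    ultimately show ?thesis by (simp add: i')
  qed
  have Z': "S \<union> set (x # u # us) = insert x Z" by (auto simp: Z_def)
  have path: "\<exists>v\<in>nbrs H ((x # u # us) ! Suc t). {v, (x # u # us) ! t} \<in> insert {w, x} K"
    if "Suc t < length (x # u # us)" for t
    using E(6)[of "t - 1"] that assms(3) by (cases t) auto
  show "explored n H D S (x # u # us) (insert {w, x} R) (insert {w, x} K)"
    unfolding explored_def Z'
  proof (intro conjI)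
    show "distinct (x # u # us)" "S \<inter> set (x # u # us) = {}"
      using E(2,3) xZ' by auto
    show "insert {w, x} R \<subseteq> all_edges n" "insert {w, x} K \<subseteq> insert {w, x} R"
      using e E(4,5) by auto
    show "\<forall>s\<in>S. \<forall>v\<in>nbrs H s. \<forall>y\<in>free n H D (insert x Z). {v, y} \<in> insert {w, x} R"
      using done_R free_insert_subset by blast
    show "\<forall>e\<in>insert {w, x} R. \<exists>z\<in>insert x Z. \<exists>v\<in>nbrs H z. v \<in> e"
      using cov by blast
    show "\<forall>t. Suc t < length (x # u # us) \<longrightarrow>
        (\<exists>v\<in>nbrs H ((x # u # us) ! Suc t). {v, (x # u # us) ! t} \<in> insert {w, x} K)"
      using path by blast
    show "\<forall>j i. j < i \<longrightarrow> i < length (x # u # us) \<longrightarrow>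
        (\<forall>v\<in>nbrs H ((x # u # us) ! j). {v, (x # u # us) ! i} \<notin> insert {w, x} R)"
      using new by blast
  qed (rule sep)
qed

section \<open>Failure probability of the exploration\<close>

text \<open>Closing pairs join a neighbour of a later centre to an earlier centre, which are exactly
  the pairs the exploration never queries. Their presence is still independent of everything
  seen.\<close>

lemma closing_unexposed:
  assumes H: "H \<in> k_factors k n" and k: "k \<ge> 1"
    and E: "explored n H D S us R K" and us: "length us = 3 * m"
  shows "closing H us m \<subseteq> all_edges n - R"
proof
  note E = exploredD[OF E]
  fix e assume "e \<in> closing H us m"
  then obtain j i where b: "j < m" "2 * m \<le> i" "i < 3 * m"
    and e: "e = {port H (us ! j), us ! i}"
    by (auto simp: closing_def)
  have mem: "us ! t \<in> S \<union> set us" if "t < 3 * m" for t using us that by simp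
  have lt: "us ! t < n" if "t < 3 * m" for t using mem[OF that] E(1) by (auto simp: separated_def)
  have p: "port H (us ! j) \<in> nbrs H (us ! j)" using port_in_nbrs[OF H k] lt b by simp
  have "us ! i \<notin> nbrs H (us ! j)"
    using centre_not_nbr[OF H E(1) mem mem, of i j] b by simp
  then have "e \<in> all_edges n"
    using p nbrs_bounds[OF H p] lt[of i] b by (auto simp: e all_edges_iff)
  moreover have "e \<notin> R" using E(8)[of j i] p b us by (simp add: e)
  ultimately show "e \<in> all_edges n - R" by simp
qed

text \<open>Each finished centre, neighbour of it and free vertex give an exposed pair, and disjoint
  stars keep these pairs distinct. Many finished centres thus certify many queries.\<close>

lemma card_exposed_ge:
  assumes H: "H \<in> k_factors k n" and E: "explored n H D S us R K"
  shows "k * card S * card (free n H D (S \<union> set us)) \<le> card R"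
proof -
  note E = exploredD[OF E]
  let ?T = "free n H D (S \<union> set us)" and ?P = "Sigma S (nbrs H)"
  have SZ: "S \<subseteq> {..<n}" using E(1) by (auto simp: separated_def)
  then have finS: "finite S" by (rule finite_subset) simp
  have "card ?P = (\<Sum>s\<in>S. card (nbrs H s))"
    using finS finite_nbrs[OF H] by (intro card_SigmaI) auto
  also have "\<dots> = (\<Sum>s\<in>S. k)"
    using SZ by (intro sum.cong card_nbrs[OF H]) auto
  finally have P: "card ?P = k * card S" by simp
  have "inj_on (\<lambda>((s, w), x). {w, x}) (?P \<times> ?T)"
  proof (rule inj_onI, clarsimp)
    fix s w x s' w' x'
    assume a: "s \<in> S" "w \<in> nbrs H s" "x \<in> ?T" "s' \<in> S" "w' \<in> nbrs H s'" "x' \<in> ?T"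
      and eq: "{w, x} = {w', x'}"
    have "w \<noteq> x'"
      using free_notin[OF a(6) _ self_in_star, of s] a(1) nbrs_in_star[OF a(2)] by auto
    then have "w = w'" "x = x'" using eq by (auto simp: doubleton_eq_iff)
    moreover have "s = s'"
      using separated_eq[OF E(1), of s s' w] a \<open>w = w'\<close> by (auto simp: nbrs_in_star)
    ultimately show "s = s' \<and> w = w' \<and> x = x'" by simp
  qed
  then have "card (?P \<times> ?T) = card ((\<lambda>((s, w), x). {w, x}) ` (?P \<times> ?T))"
    by (simp add: card_image)
  also have "\<dots> \<le> card R"
    using E(4,7) by (intro card_mono) (auto intro: finite_subset[OF _ finite_all_edges])
  finally show ?thesis by (simp add: card_cartesian_product P)
qed

text \<open>The right-hand side is a supermartingale for the exploration: a query multiplies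
  \<open>exp (\<theta> (a - card (S \<union> set us)) + p (1 - exp (-\<theta>)) card R)\<close> in the mean
  by at most \<open>1\<close>.\<close>
lemma exploration_bound:
  fixes p \<theta> :: real
  assumes H: "H \<in> k_factors k n" and k: "k \<ge> 1" and m: "m \<ge> 1"
    and p: "0 \<le> p" "p \<le> 1" and \<theta>: "0 \<le> \<theta>"
    and D: "finite D" "card D \<le> d" and room: "(k + 1) * (d + (k + 1) * a) < n"
  defines "q \<equiv> k * (a - 3 * m) * (n - (k + 1) * (d + (k + 1) * a))"
    and "\<rho> \<equiv> p * (1 - exp (- \<theta>))"
  assumes "explored n H D S us R K" "length us \<le> 3 * m" "card (S \<union> set us) \<le> a"
  shows "bexp p (all_edges n - R) (\<lambda>G. of_bool (\<not> switchable k n H D m (K \<union> G)))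
    \<le> exp (\<theta> * (real a - real (card (S \<union> set us))) - \<rho> * (real q - real (card R)))
      + (1 - p) ^ (m * m)"
  using assms(12-)
\<comment> \<open>The weight 2 pays for the stack growing when a centre is added: a restart lowers
  the measure by 1 although the stack gains an element. A pop shortens the stack, and a query
  removes an unexposed pair.\<close>
proof (induction "card (all_edges n - R) + 2 * (a - card (S \<union> set us)) + length us"
    arbitrary: S us R K rule: less_induct)
  case (less S us R K)
  note E = exploredD[OF less.prems(1)]
  let ?Z = "S \<union> set us"
  let ?F = "\<lambda>R K. bexp p (all_edges n - R) (\<lambda>G. of_bool (\<not> switchable k n H D m (K \<union> G)))"
  let ?\<Phi> = "\<lambda>z r. exp (\<theta> * (real a - real z) - \<rho> * (real q - real r))"
  have \<rho>: "0 \<le> \<rho>" using p \<theta> by (simp add: \<rho>_def)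
  have pow: "0 \<le> (1 - p) ^ (m * m)" using p by simp
  have ZV: "?Z \<subseteq> {..<n}" using E(1) by (auto simp: separated_def)
  then have finZ: "finite ?Z" by (rule finite_subset) simp
  have free_ge: "n - (k + 1) * (d + (k + 1) * a) \<le> card (free n H D ?Z)"
    using card_free_ge[OF H D ZV less.prems(3)] .
  \<comment> \<open>Either the path is long enough, or \<open>a\<close> centres are used up, or the
    exploration can go on.\<close>
  consider (close) "length us = 3 * m" | (stop) "card ?Z = a"
    | (go) "length us < 3 * m" "card ?Z < a"
    using less.prems by linarith
  then show ?case
  proof cases
    case close
    have sub: "closing H us m \<subseteq> all_edges n - R"
      using closing_unexposed[OF H k less.prems(1) close] .
    have sep: "separated n H D (set us)"
      using E(1) by (auto simp: separated_def)
    \<comment> \<open>With a path of \<open>3 * m\<close> centres, failure requires all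
      \<open>m * m\<close> closing pairs to be absent.\<close>
    have "?F R K \<le> bexp p (all_edges n - R) (\<lambda>G. of_bool (G \<inter> closing H us m = {}))"
    proof (rule bexp_mono[OF p])
      fix G
      have "switchable k n H D m (K \<union> G)" if "G \<inter> closing H us m \<noteq> {}"
        using that E(6) close
        by (intro switchable_closing[OF H k m sep E(2) close]) auto
      then show "of_bool (\<not> switchable k n H D m (K \<union> G))
          \<le> (of_bool (G \<inter> closing H us m = {}) :: real)"
        by auto
    qed
    also have "\<dots> = (1 - p) ^ (m * m)"
      using bexp_disjoint[OF _ sub] card_closing[OF H k sep E(2) close] by simp
    finally show ?thesis
      using exp_ge_zero[of "\<theta> * (real a - real (card ?Z)) - \<rho> * (real q - real (card R))"]
      by linarith
  next
    case stop
    have "card ?Z = card S + length us"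
      using card_Un_disjoint[of S "set us"] E(2,3) finZ by (simp add: distinct_card)
    \<comment> \<open>At most \<open>3 * m\<close> centres are on the stack, so the others are
      finished and have cost at least \<open>q\<close> queries. The exponent is then nonnegative and
      the bound trivial.\<close>
    then have "a - 3 * m \<le> card S" using stop less.prems(2) by linarith
    then have "q \<le> k * card S * card (free n H D ?Z)"
      unfolding q_def using free_ge by (intro mult_le_mono) auto
    also have "\<dots> \<le> card R" using card_exposed_ge[OF H less.prems(1)] .
    finally have "real q - real (card R) \<le> 0" by simp
    then have "1 \<le> ?\<Phi> (card ?Z) (card R)"
      using stop \<rho> by (simp add: mult_nonneg_nonpos)
    moreover have "?F R K \<le> bexp p (all_edges n - R) (\<lambda>G. 1)"
      by (rule bexp_mono[OF p]) simp
    then have "?F R K \<le> 1" by (simp add: bexp_const)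
    ultimately show ?thesis using pow by linarith
  next
    case go
    show ?thesis
    proof (cases us)
      case Nil
      have "card (free n H D S) > 0" using free_ge room Nil by simp
      then obtain x where x: "x \<in> free n H D S" by (auto simp: card_gt_0_iff)
      then have xS: "x \<notin> S" using free_notin[of x n H D S x x] self_in_star by auto
      then have card: "card (S \<union> set [x]) = Suc (card S)" using finZ Nil by simp
      have "?F R K \<le> ?\<Phi> (card (S \<union> set [x])) (card R) + (1 - p) ^ (m * m)"
      proof (rule less.hyps)
        show "explored n H D S [x] R K"
          using explored_restart[OF _ x] less.prems(1) Nil by simp
      qed (use go card Nil m in \<open>auto\<close>)
      also have "?\<Phi> (card (S \<union> set [x])) (card R) \<le> ?\<Phi> (card ?Z) (card R)"
        using \<theta> card Nil by (simp add: mult_left_mono)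
      finally show ?thesis by simp
    next
      case us: (Cons u us')
      show ?thesis
      proof (cases "\<forall>w\<in>nbrs H u. \<forall>x\<in>free n H D ?Z. {w, x} \<in> R")
        case True
        have Z: "insert u S \<union> set us' = ?Z" using us by auto
        have "?F R K \<le> ?\<Phi> (card (insert u S \<union> set us')) (card R) + (1 - p) ^ (m * m)"
        proof (rule less.hyps)
          show "explored n H D (insert u S) us' R K"
            using explored_pop[of n H D S u us' R K] less.prems(1) True us by auto
        qed (use go us less.prems Z in \<open>auto\<close>)
        then show ?thesis unfolding Z .
      next
        case False
        then obtain w x where wx: "w \<in> nbrs H u" "x \<in> free n H D ?Z" "{w, x} \<notin> R" by blast
        define e where "e = {w, x}"
        note Q = explored_query[OF H less.prems(1)[unfolded us] wx(1) wx(2)[unfolded us],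
            folded us e_def]
        define E' where "E' = all_edges n - insert e R"
        have E': "all_edges n - R = insert e E'" "e \<notin> E'" "finite E'"
          using Q(1) wx(3) by (auto simp: E'_def e_def)
        have finR: "finite R" using E(4) by (rule finite_subset) simp
        have cardR: "card (insert e R) = Suc (card R)" using finR wx(3) by (simp add: e_def)
        have card: "card (S \<union> set (x # us)) = Suc (card ?Z)" using Q(4) finZ by simp
        have less: "card E' < card (all_edges n - R)"
          using E' by simp
        have neg: "?F (insert e R) K \<le> ?\<Phi> (card ?Z) (Suc (card R)) + (1 - p) ^ (m * m)"
          unfolding cardR[symmetric]
          by (rule less.hyps[OF _ Q(2) less.prems(2,3)]) (use less in \<open>simp add: E'_def\<close>)
        have pos: "?F (insert e R) (insert e K)
            \<le> ?\<Phi> (Suc (card ?Z)) (Suc (card R)) + (1 - p) ^ (m * m)"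
          unfolding cardR[symmetric] card[symmetric]
          by (rule less.hyps[OF _ Q(3)]) (use less go card in \<open>auto simp: E'_def\<close>)
        have "?F R K = p * ?F (insert e R) (insert e K) + (1 - p) * ?F (insert e R) K"
          unfolding E'(1) E'_def[symmetric] bexp_insert[OF E'(3,2)] by simp
        also have "\<dots> \<le> p * (?\<Phi> (Suc (card ?Z)) (Suc (card R)) + (1 - p) ^ (m * m))
            + (1 - p) * (?\<Phi> (card ?Z) (Suc (card R)) + (1 - p) ^ (m * m))"
          using pos neg p by (intro add_mono mult_left_mono) auto
        also have "\<dots> = (1 - p + p * exp (- \<theta>)) * exp \<rho> * ?\<Phi> (card ?Z) (card R)
            + (1 - p) ^ (m * m)"
        proof -
          have "?\<Phi> (card ?Z) (Suc (card R)) = exp \<rho> * ?\<Phi> (card ?Z) (card R)"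
            unfolding exp_add[symmetric] by (simp add: algebra_simps)
          moreover have "?\<Phi> (Suc (card ?Z)) (Suc (card R))
              = exp (- \<theta>) * (exp \<rho> * ?\<Phi> (card ?Z) (card R))"
            unfolding exp_add[symmetric] by (simp add: algebra_simps)
          ultimately show ?thesis by (simp only:) (simp add: algebra_simps)
        qed
        \<comment> \<open>The first factor equals \<open>1 - \<rho>\<close>, so one query does not
          increase the bound in the mean.\<close>
        also have "(1 - p + p * exp (- \<theta>)) * exp \<rho> \<le> exp (- \<rho>) * exp \<rho>"
          using exp_ge_add_one_self[of "- \<rho>"]
          by (intro mult_right_mono) (auto simp: \<rho>_def algebra_simps)
        also have "\<dots> = 1" by (simp add: exp_minus)
        finally show ?thesis by simp
      qed
    qed
  qed
qed

section \<open>Many k-factors\<close>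

text \<open>Spending \<open>a\<close> centres without a long path takes \<open>q\<close> queries,
  which yield at least \<open>(1 + e) * (1 - e / 8)\<^sup>2 * a\<close> edges on average, more than
  \<open>a\<close>. The choice \<open>\<theta> = e / 8\<close> turns this surplus into the first
  term; the second is the chance that no closing pair is present.\<close>

lemma switchable_failure_le:
  fixes e :: real
  assumes H: "H \<in> k_factors k n" and k: "k \<ge> 1" and m: "m \<ge> 1" and e: "0 < e" "e \<le> 1"
    and p: "p = (1 + e) / (real k * real n)" "p \<le> 1"
    and D: "finite D" "card D \<le> d"
    and room: "real ((k + 1) * (d + (k + 1) * a)) \<le> e / 8 * real n" and n: "n \<ge> 1"
    and am: "24 * real m \<le> e * real a"
  shows "bexp p (all_edges n) (\<lambda>G. of_bool (\<not> switchable k n H D m G))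
    \<le> exp (- (e\<^sup>2 / 32) * real a) + exp (- (real m)\<^sup>2 / (real k * real n))"
proof -
  define b where "b = (k + 1) * (d + (k + 1) * a)"
  define q where "q = k * (a - 3 * m) * (n - b)"
  define \<theta> where "\<theta> = e / 8"
  define \<rho> where "\<rho> = p * (1 - exp (- \<theta>))"
  have kn: "real k * real n > 0" using k n by simp
  have p0: "0 \<le> p" using p kn e by simp
  have pkn: "p * (real k * real n) = 1 + e" using p(1) k n by simp
  have b: "real b \<le> e / 8 * real n" using room by (simp add: b_def)
  also have "\<dots> < real n" using e n by simp
  finally have bn: "b < n" by simp
  have "e * real a \<le> 1 * real a" using e by (intro mult_right_mono) auto
  then have ma: "3 * m \<le> a" using am by linarith
  have inv: "explored n H D {} [] {} {}"
    by (simp add: explored_def separated_def)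
  have "bexp p (all_edges n) (\<lambda>G. of_bool (\<not> switchable k n H D m G))
      \<le> exp (\<theta> * real a - \<rho> * real q) + (1 - p) ^ (m * m)"
    using exploration_bound[OF H k m p0 p(2) _ D bn[unfolded b_def] inv, of \<theta>] e
    by (simp add: \<theta>_def \<rho>_def q_def b_def)
  also have "exp (\<theta> * real a - \<rho> * real q) \<le> exp (- (e\<^sup>2 / 32) * real a)"
  proof -
    have r: "0 \<le> 1 - e / 8" using e by simp
    have q: "real q = real k * (real a - 3 * real m) * (real n - real b)"
      using ma bn by (simp add: q_def of_nat_diff)
    \<comment> \<open>The stack and the blocked vertices each cost a factor of at most
      \<open>1 - e / 8\<close> in \<open>q\<close>.\<close>
    have "(1 - e / 8) * real a \<le> real a - 3 * real m"
      using am by (simp add: algebra_simps)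
    moreover have "(1 - e / 8) * real n \<le> real n - real b"
      using b by (simp add: algebra_simps)
    ultimately have "real k * ((1 - e / 8) * real a) * ((1 - e / 8) * real n) \<le> real q"
      unfolding q using r ma by (intro mult_mono) auto
    then have q': "(1 - e / 8)\<^sup>2 * (real k * real n) * real a \<le> real q"
      by (simp add: power2_eq_square mult_ac)
    have \<rho>0: "0 \<le> \<rho>" using p0 e by (simp add: \<rho>_def \<theta>_def)
    \<comment> \<open>A third factor \<open>1 - e / 8\<close> is lost when
      \<open>1 - exp (- \<theta>)\<close> is linearised.\<close>
    have "exp (- \<theta>) \<le> 1 / (1 + \<theta>)"
      using exp_ge_add_one_self[of \<theta>] e unfolding exp_minus inverse_eq_divide
      by (intro divide_left_mono) (auto simp: \<theta>_def)
    also have "\<dots> \<le> 1 - \<theta> * (1 - \<theta>)"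
      using e by (simp add: \<theta>_def field_simps)
    finally have "p * (\<theta> * (1 - e / 8)) \<le> \<rho>"
      unfolding \<rho>_def using p0 by (intro mult_left_mono) (auto simp: \<theta>_def)
    then have "p * (\<theta> * (1 - e / 8)) * ((1 - e / 8)\<^sup>2 * (real k * real n) * real a) \<le> \<rho> * real q"
      using q' p0 r e \<rho>0 by (intro mult_mono) (auto simp: \<theta>_def)
    also have "p * (\<theta> * (1 - e / 8)) * ((1 - e / 8)\<^sup>2 * (real k * real n) * real a)
        = \<theta> * ((1 + e) * (1 - e / 8) ^ 3) * real a"
      unfolding pkn[symmetric] by (simp add: power3_eq_cube power2_eq_square mult_ac)
    finally have 1: "\<theta> * ((1 + e) * (1 - e / 8) ^ 3) * real a \<le> \<rho> * real q" .
    \<comment> \<open>Of the surplus \<open>e\<close>, at least \<open>e / 4\<close> survives the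
      three losses because \<open>e \<le> 1\<close>; multiplied by \<open>\<theta>\<close> it gives
      the rate \<open>e\<^sup>2 / 32\<close>.\<close>
    have "1 - 3 * (e / 8) \<le> (1 - e / 8) ^ 3"
      using Bernoulli_inequality[of "- (e / 8)" 3] e by simp
    then have "(1 + e) * (1 - 3 * (e / 8)) \<le> (1 + e) * (1 - e / 8) ^ 3"
      using e by (intro mult_left_mono) auto
    moreover have "e * e \<le> e * 1" using e by (intro mult_left_mono) auto
    then have "1 + e / 4 \<le> (1 + e) * (1 - 3 * (e / 8))"
      by (simp add: field_simps)
    ultimately have "1 + e / 4 \<le> (1 + e) * (1 - e / 8) ^ 3" by linarith
    then have "\<theta> * (1 + e / 4) * real a \<le> \<theta> * ((1 + e) * (1 - e / 8) ^ 3) * real a"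
      using e by (intro mult_right_mono mult_left_mono) (auto simp: \<theta>_def)
    then have "\<theta> * (1 + e / 4) * real a \<le> \<rho> * real q" using 1 by linarith
    then have "\<theta> * real a - \<rho> * real q \<le> - (e\<^sup>2 / 32) * real a"
      by (simp add: \<theta>_def algebra_simps power2_eq_square)
    then show ?thesis by simp
  qed
  also have "(1 - p) ^ (m * m) \<le> exp (- (real m)\<^sup>2 / (real k * real n))"
  proof -
    have "(1 - p) ^ (m * m) \<le> exp (- p) ^ (m * m)"
      using exp_ge_add_one_self[of "- p"] p(2) by (intro power_mono) auto
    also have "\<dots> = exp (- (p * (real m)\<^sup>2))"
      by (simp add: exp_of_nat_mult[symmetric] power2_eq_square mult_ac)
    also have "\<dots> \<le> exp (- (real m)\<^sup>2 / (real k * real n))"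
    proof -
      have "1 / (real k * real n) \<le> p" unfolding p(1) using kn e by (intro divide_right_mono) auto
      then have "1 / (real k * real n) * (real m)\<^sup>2 \<le> p * (real m)\<^sup>2"
        by (rule mult_right_mono) simp
      then show ?thesis by simp
    qed
    finally show ?thesis .
  qed
  finally show ?thesis by simp
qed

lemma nat_floor_ge_half:
  fixes x :: real
  assumes "x \<ge> 2"
  shows "x / 2 \<le> real (nat \<lfloor>x\<rfloor>)" "real (nat \<lfloor>x\<rfloor>) \<le> x"
  using assms by linarith+

text \<open>All sizes are taken linear in \<open>n\<close>. The threshold \<open>m\<close> is chosen
  before \<open>H\<close> and \<open>D\<close>, and the rate \<open>c\<close> is uniform in them, as
  the union bound over \<open>D\<close> requires.\<close>

lemma switchable_whp:
  fixes e :: real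
  assumes k: "k \<ge> 1" and e: "0 < e" "e \<le> 1"
  shows "\<exists>\<delta>>0. \<exists>\<mu>>0. \<exists>c>0. \<exists>N. \<forall>n\<ge>N. \<exists>m. \<mu> * real n \<le> real m \<and>
    (\<forall>H\<in>k_factors k n. \<forall>D. finite D \<and> real (card D) \<le> \<delta> * real n \<longrightarrow>
      bexp ((1 + e) / (real k * real n)) (all_edges n)
        (\<lambda>G. of_bool (\<not> switchable k n H D m G)) \<le> 2 * exp (- c * real n))"
proof -
  define K where "K = real (k + 1)"
  \<comment> \<open>With these values \<open>D\<close> and the stars of \<open>a\<close> centres
    each block at most \<open>e / 16 * n\<close> vertices, together the allowed
    \<open>e / 8 * n\<close>.\<close>
  define \<alpha> where "\<alpha> = e / (16 * K\<^sup>2)"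
  define \<delta> where "\<delta> = e / (16 * K)"
  \<comment> \<open>The factor \<open>1 / 24\<close> comes from the size of \<open>m\<close>
    relative to \<open>e * a\<close>, the remaining \<open>1 / 4\<close> from two roundings.\<close>
  define \<mu> where "\<mu> = e * \<alpha> / 96"
  define c where "c = min (e\<^sup>2 / 32 * (\<alpha> / 2)) (\<mu>\<^sup>2 / real k)"
  have K: "K > 0" by (simp add: K_def)
  have pos: "\<alpha> > 0" "\<delta> > 0" "\<mu> > 0" using e K by (simp_all add: \<alpha>_def \<delta>_def \<mu>_def)
  have c_le: "c \<le> e\<^sup>2 / 32 * (\<alpha> / 2)" "c \<le> \<mu>\<^sup>2 / real k"
    unfolding c_def by (rule min.cobounded1, rule min.cobounded2)
  have c: "c > 0" using pos e k by (simp add: c_def)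
  define N where "N = nat \<lceil>2 + 2 / \<alpha> + 2 / \<mu>\<rceil>"
  show ?thesis
  proof (rule exI[of _ \<delta>], rule conjI[OF pos(2)], rule exI[of _ \<mu>], rule conjI[OF pos(3)],
      rule exI[of _ c], rule conjI[OF c], rule exI[of _ N], intro allI impI)
    fix n assume "n \<ge> N"
    then have "real n \<ge> 2 + 2 / \<alpha> + 2 / \<mu>" by (simp add: N_def)
    moreover have "2 / \<alpha> > 0" "2 / \<mu> > 0" using pos by auto
    ultimately have n: "real n \<ge> 2" "real n \<ge> 2 / \<alpha>" "real n \<ge> 2 / \<mu>" by linarith+
    define a where "a = nat \<lfloor>\<alpha> * real n\<rfloor>"
    define m where "m = nat \<lfloor>e * real a / 24\<rfloor>"
    have "\<alpha> * real n \<ge> 2" using n(2) pos by (simp add: field_simps)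
    then have a: "\<alpha> * real n / 2 \<le> real a" "real a \<le> \<alpha> * real n"
      unfolding a_def by (rule nat_floor_ge_half)+
    have "\<mu> * real n \<ge> 2" using n(3) pos by (simp add: field_simps)
    moreover have ea: "2 * (\<mu> * real n) \<le> e * real a / 24"
      using mult_left_mono[OF a(1), of e] e by (simp add: \<mu>_def field_simps)
    ultimately have "e * real a / 24 \<ge> 2" by linarith
    then have m: "e * real a / 24 / 2 \<le> real m" "real m \<le> e * real a / 24"
      unfolding m_def by (rule nat_floor_ge_half)+
    have \<mu>m: "\<mu> * real n \<le> real m" using ea m(1) by linarith
    then have m1: "m \<ge> 1" using \<open>\<mu> * real n \<ge> 2\<close> by linarith
    have pl: "(1 + e) / (real k * real n) \<le> 1"
    proof -
      have "1 * 2 \<le> real k * real n" using k n(1) by (intro mult_mono) auto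
      then show ?thesis using e by (simp add: divide_le_eq)
    qed
    show "\<exists>m. \<mu> * real n \<le> real m \<and>
      (\<forall>H\<in>k_factors k n. \<forall>D. finite D \<and> real (card D) \<le> \<delta> * real n \<longrightarrow>
        bexp ((1 + e) / (real k * real n)) (all_edges n)
          (\<lambda>G. of_bool (\<not> switchable k n H D m G)) \<le> 2 * exp (- c * real n))"
    proof (intro exI[of _ m] conjI \<mu>m ballI allI impI)
      fix H :: "nat set set" and D :: "nat set"
      assume H: "H \<in> k_factors k n" and D: "finite D \<and> real (card D) \<le> \<delta> * real n"
      have "K * real (card D) \<le> e / 16 * real n"
        using mult_left_mono[OF conjunct2[OF D], of K] K by (simp add: \<delta>_def)
      moreover have "K\<^sup>2 * real a \<le> e / 16 * real n"
        using mult_left_mono[OF a(2), of "K\<^sup>2"] K by (simp add: \<alpha>_def)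
      ultimately have room: "real ((k + 1) * (card D + (k + 1) * a)) \<le> e / 8 * real n"
        unfolding of_nat_mult of_nat_add[of "card D"] K_def[symmetric]
        by (simp add: algebra_simps power2_eq_square)
      have "bexp ((1 + e) / (real k * real n)) (all_edges n)
          (\<lambda>G. of_bool (\<not> switchable k n H D m G))
          \<le> exp (- (e\<^sup>2 / 32) * real a) + exp (- (real m)\<^sup>2 / (real k * real n))"
        using n(1) m(2) D
        by (intro switchable_failure_le[OF H k m1 e refl pl _ order_refl room]) auto
      also have "exp (- (e\<^sup>2 / 32) * real a) \<le> exp (- c * real n)"
      proof -
        have "c * real n \<le> e\<^sup>2 / 32 * (\<alpha> / 2) * real n"
          using c_le by (intro mult_right_mono) auto
        also have "\<dots> \<le> e\<^sup>2 / 32 * real a"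
          using mult_left_mono[OF a(1), of "e\<^sup>2 / 32"] by simp
        finally show ?thesis by simp
      qed
      also have "exp (- (real m)\<^sup>2 / (real k * real n)) \<le> exp (- c * real n)"
      proof -
        have "(\<mu> * real n)\<^sup>2 \<le> (real m)\<^sup>2" using \<mu>m pos by (intro power_mono) auto
        then have "(\<mu> * real n)\<^sup>2 / (real k * real n) \<le> (real m)\<^sup>2 / (real k * real n)"
          by (rule divide_right_mono) simp
        moreover have "(\<mu> * real n)\<^sup>2 / (real k * real n) = \<mu>\<^sup>2 / real k * real n"
          using n(1) by (simp add: power2_eq_square field_simps)
        moreover have "c * real n \<le> \<mu>\<^sup>2 / real k * real n"
          using c_le by (intro mult_right_mono) auto
        ultimately show ?thesis by simp
      qed
      finally show "bexp ((1 + e) / (real k * real n)) (all_edges n)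
          (\<lambda>G. of_bool (\<not> switchable k n H D m G)) \<le> 2 * exp (- c * real n)"
        by simp
    qed
  qed
qed

section \<open>Counting small subsets and avoiding subsets\<close>

lemma sum_Pow_power_card:
  fixes x :: real
  assumes "finite G"
  shows "(\<Sum>A\<in>Pow G. x ^ card A) = (1 + x) ^ card G"
proof -
  have "(\<Sum>A\<in>Pow G. x ^ card A) = (\<Sum>A\<in>Pow G. (\<Prod>_\<in>A. x) * (\<Prod>_\<in>G - A. 1))" by simp
  also have "\<dots> = (\<Prod>_\<in>G. x + 1)" using prod_add[OF assms, of "\<lambda>_. x" "\<lambda>_. 1"] by simp
  finally show ?thesis by (simp add: add.commute)
qed

text \<open>A Chernoff argument: weight each subset by \<open>x ^ card A\<close>. The counted sets
  weigh at least \<open>x\<close> to the power \<open>r\<close>, and the total weight is at most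
  \<open>exp (x * card G)\<close>.\<close>

lemma card_small_subsets_le:
  fixes x r :: real
  assumes G: "finite G" and x: "0 < x" "x \<le> 1"
  shows "real (card {A. A \<subseteq> G \<and> real (card A) \<le> r}) \<le> exp (x * real (card G) + r * ln (1 / x))"
proof -
  have sub: "{A. A \<subseteq> G \<and> real (card A) \<le> r} \<subseteq> Pow G" by auto
  have "real (card {A. A \<subseteq> G \<and> real (card A) \<le> r})
      = (\<Sum>A\<in>{A. A \<subseteq> G \<and> real (card A) \<le> r}. 1)" by simp
  also have "\<dots> \<le> (\<Sum>A\<in>{A. A \<subseteq> G \<and> real (card A) \<le> r}. exp (r * ln (1 / x)) * x ^ card A)"
  proof (rule sum_mono)
    fix A assume A: "A \<in> {A. A \<subseteq> G \<and> real (card A) \<le> r}"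
    have "exp (r * ln (1 / x)) * x ^ card A = exp (r * ln (1 / x)) * exp (real (card A) * ln x)"
      using x by (simp add: exp_of_nat_mult)
    also have "\<dots> = exp ((r - real (card A)) * ln (1 / x))"
      unfolding exp_add[symmetric] using x by (simp add: ln_div algebra_simps)
    finally show "1 \<le> exp (r * ln (1 / x)) * x ^ card A"
      using A x by simp
  qed
  also have "\<dots> \<le> (\<Sum>A\<in>Pow G. exp (r * ln (1 / x)) * x ^ card A)"
    using G x by (intro sum_mono2 sub) auto
  also have "\<dots> = exp (r * ln (1 / x)) * (1 + x) ^ card G"
    by (simp add: sum_distrib_left[symmetric] sum_Pow_power_card[OF G])
  also have "\<dots> \<le> exp (r * ln (1 / x)) * exp x ^ card G"
    using exp_ge_add_one_self[of x] x by (intro mult_left_mono power_mono) auto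
  also have "\<dots> = exp (x * real (card G) + r * ln (1 / x))"
    by (simp add: exp_of_nat_mult[symmetric] exp_add[symmetric] algebra_simps)
  finally show ?thesis .
qed

text \<open>Applied twice: to the vertex sets \<open>D\<close>, and to the edge sets by which
  k-factors near the estimate differ. First \<open>x\<close> is taken small against
  \<open>a / C\<close>, then \<open>\<tau>\<close> small against \<open>ln (1 / x)\<close>.\<close>

lemma few_small_subsets:
  fixes C a :: real
  assumes "C > 0" "a > 0"
  shows "\<exists>\<tau>>0. \<forall>G :: 'a set. \<forall>n::nat. finite G \<and> real (card G) \<le> C * real n \<longrightarrow>
    real (card {A. A \<subseteq> G \<and> real (card A) \<le> \<tau> * real n}) \<le> exp (a * real n)"
proof -
  define x where "x = min 1 (a / (2 * C))"
  define l where "l = ln (1 / x)"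
  \<comment> \<open>The summand 1 keeps the denominator positive when \<open>x = 1\<close> and
    \<open>l = 0\<close>.\<close>
  define \<tau> where "\<tau> = a / (2 * (l + 1))"
  have x: "0 < x" "x \<le> 1" "x * C \<le> a / 2"
    using assms by (auto simp: x_def min_def field_simps)
  have l: "0 \<le> l" using x by (simp add: l_def)
  then have \<tau>: "\<tau> > 0" using assms by (simp add: \<tau>_def)
  have "\<tau> * l \<le> \<tau> * (l + 1)" using \<tau> by simp
  also have "\<dots> = a / 2"
  proof -
    have "a / (2 * y) * y = a / 2" if "y \<noteq> 0" for y :: real using that by simp
    then show ?thesis using l by (simp only: \<tau>_def)
  qed
  finally have \<tau>l: "\<tau> * l \<le> a / 2" .
  show ?thesis
  proof (intro exI[of _ \<tau>] conjI \<tau> allI impI)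
    fix G :: "'a set" and n :: nat
    assume G: "finite G \<and> real (card G) \<le> C * real n"
    have "x * real (card G) \<le> x * (C * real n)" using G x by (intro mult_left_mono) auto
    also have "\<dots> \<le> a / 2 * real n" using mult_right_mono[OF x(3), of "real n"] by simp
    finally have "x * real (card G) + \<tau> * real n * l \<le> a / 2 * real n + \<tau> * l * real n" by simp
    also have "\<dots> \<le> a * real n" using mult_right_mono[OF \<tau>l, of "real n"] by simp
    finally have "exp (x * real (card G) + \<tau> * real n * l) \<le> exp (a * real n)" by simp
    then show "real (card {A. A \<subseteq> G \<and> real (card A) \<le> \<tau> * real n}) \<le> exp (a * real n)"
      using card_small_subsets_le[OF conjunct1[OF G] x(1,2), of "\<tau> * real n"]
      unfolding l_def by linarith
  qed
qed

text \<open>The ratio of the binomials is the chance that a random \<open>d\<close>-set avoids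
  \<open>m\<close> given points. Each point costs a factor \<open>1 - d / N\<close> with
  \<open>N \<le> n\<close>, hence at most \<open>exp (- d / n)\<close>.\<close>

lemma binomial_diff_le:
  assumes "m \<le> n"
  shows "real ((n - m) choose d) \<le> real (n choose d) * exp (- (real d * real m / real n))"
  using assms
proof (induction m)
  case (Suc m)
  define N where "N = n - m"
  have N: "N \<ge> 1" "N \<le> n" "n - Suc m = N - 1" using Suc.prems by (auto simp: N_def)
  have "real (N - 1 choose d) \<le> real (N choose d) * exp (- (real d / real n))"
  proof (cases "d \<le> N")
    case True
    have "real (N - d) * real (N choose d) = real N * real (N - 1 choose d)"
      unfolding of_nat_mult[symmetric] by (simp only: binomial_absorb_comp)
    then have "real (N - 1 choose d) = real (N choose d) * (1 - real d / real N)"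
      using N(1) True by (simp add: field_simps of_nat_diff)
    also have "\<dots> \<le> real (N choose d) * (1 - real d / real n)"
      using N by (intro mult_left_mono diff_left_mono divide_left_mono) auto
    also have "\<dots> \<le> real (N choose d) * exp (- (real d / real n))"
      using exp_ge_add_one_self[of "- (real d / real n)"] by (intro mult_left_mono) auto
    finally show ?thesis .
  qed (simp add: binomial_eq_0)
  also have "\<dots> \<le> real (n choose d) * exp (- (real d * real m / real n)) * exp (- (real d / real n))"
    using Suc by (intro mult_right_mono) (auto simp: N_def)
  also have "\<dots> = real (n choose d) * exp (- (real d * real (Suc m) / real n))"
    by (simp add: exp_add[symmetric] mult.assoc add_divide_distrib algebra_simps)
  finally show ?case unfolding N(3) .
qed simp

section \<open>From switches to many k-factors\<close>

definition k_factors_in :: "nat \<Rightarrow> nat \<Rightarrow> nat set set \<Rightarrow> nat set set set" where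
  "k_factors_in k n G = {H \<in> k_factors k n. H \<subseteq> G}"

lemma finite_k_factors_in [simp]: "finite (k_factors_in k n G)"
  by (simp add: k_factors_in_def)

text \<open>Every \<open>d\<close>-set is avoided by some switch, while a single switch moves at least \<open>m\<close>
  vertices and hence serves only few \<open>d\<close>-sets.\<close>
lemma card_k_factors_in_ge:
  assumes H: "H \<in> k_factors k n" and d: "d \<le> n"
    and sw: "\<And>D. D \<subseteq> {..<n} \<Longrightarrow> card D = d \<Longrightarrow> switchable k n H D m G"
  shows "exp (real d * real m / real n) \<le> real (card (k_factors_in k n (G \<union> H)))"
proof -
  define F where "F = k_factors_in k n (G \<union> H)"
  define X where "X H' = \<Union>(sym_diff H H')" for H'
  define F' where "F' = {H' \<in> F. m \<le> card (X H')}"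
  have finF: "finite F" "finite F'" by (auto simp: F_def F'_def)
  have XV: "X H' \<subseteq> {..<n}" if "H' \<in> F" for H'
  proof -
    have "H' \<subseteq> all_edges n" using that by (auto simp: F_def k_factors_in_def k_factors_def)
    moreover have "\<Union>(all_edges n) \<subseteq> {..<n}" by (auto simp: all_edges_def)
    ultimately show ?thesis using k_factors_subset[OF H] unfolding X_def by blast
  qed
  have cov: "{D. D \<subseteq> {..<n} \<and> card D = d}
      \<subseteq> (\<Union>H'\<in>F'. {D. D \<subseteq> {..<n} - X H' \<and> card D = d})"
  proof
    fix D assume D: "D \<in> {D. D \<subseteq> {..<n} \<and> card D = d}"
    then obtain H' where "H' \<in> k_factors k n" "H' \<subseteq> G \<union> H" "D \<inter> X H' = {}" "m \<le> card (X H')"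
      using sw[of D] unfolding switchable_def X_def by blast
    then show "D \<in> (\<Union>H'\<in>F'. {D. D \<subseteq> {..<n} - X H' \<and> card D = d})"
      using D by (auto simp: F'_def F_def k_factors_in_def)
  qed
  have "n choose d = card {D. D \<subseteq> {..<n} \<and> card D = d}"
    using n_subsets[of "{..<n}" d] by simp
  also have "\<dots> \<le> card (\<Union>H'\<in>F'. {D. D \<subseteq> {..<n} - X H' \<and> card D = d})"
    using finF by (intro card_mono cov finite_UN_I) auto
  also have "\<dots> \<le> (\<Sum>H'\<in>F'. card {D. D \<subseteq> {..<n} - X H' \<and> card D = d})"
    by (rule card_UN_le[OF finF(2)])
  also have "\<dots> \<le> (\<Sum>H'\<in>F'. (n - m) choose d)"
  proof (rule sum_mono)
    fix H' assume H': "H' \<in> F'"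
    then have "card ({..<n} - X H') = n - card (X H')"
      using XV[of H'] by (subst card_Diff_subset) (auto simp: F'_def intro: finite_subset)
    then show "card {D. D \<subseteq> {..<n} - X H' \<and> card D = d} \<le> (n - m) choose d"
      using H' n_subsets[of "{..<n} - X H'" d]
      by (simp add: F'_def binomial_right_mono diff_le_mono2)
  qed
  also have "\<dots> \<le> card F * ((n - m) choose d)"
    using finF by (auto simp: F'_def intro!: mult_le_mono1 card_mono)
  finally have le: "n choose d \<le> card F * ((n - m) choose d)" .
  have pos: "0 < n choose d" using d by simp
  \<comment> \<open>Some \<open>d\<close>-set exists, and the switch avoiding it moves at least
    \<open>m\<close> of the \<open>n\<close> vertices.\<close>
  have "m \<le> n"
  proof -
    obtain D where "D \<subseteq> {..<n}" "card D = d"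
      using obtain_subset_with_card_n[of d "{..<n}"] d by auto
    then obtain H' where "H' \<in> F" "m \<le> card (X H')"
      using cov by (auto simp: F'_def)
    then show ?thesis using card_mono[OF _ XV, of H'] by simp
  qed
  then have "real (n choose d) \<le> real (card F) * (real (n choose d) * exp (- (real d * real m / real n)))"
    using binomial_diff_le[of m n d] mult_left_mono[of _ _ "real (card F)"] le
    by (smt (verit) of_nat_0_le_iff of_nat_le_iff of_nat_mult)
  also have "\<dots> = real (n choose d) * (real (card F) * exp (- (real d * real m / real n)))" by simp
  finally have "1 \<le> real (card F) * exp (- (real d * real m / real n))"
    using pos by simp
  then show ?thesis
    unfolding F_def[symmetric] by (simp add: exp_minus field_simps)
qed

text \<open>There are at most \<open>exp (c / 2 * n)\<close> sets \<open>D\<close>, each without a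
  switch with probability at most \<open>2 * exp (- c * n)\<close>. If none fails, the double count
  gives \<open>exp (d * m / n)\<close> k-factors.\<close>

lemma many_k_factors:
  fixes e :: real
  assumes k: "k \<ge> 1" and e: "0 < e" "e \<le> 1"
  shows "\<exists>a>0. \<exists>c>0. \<exists>N. \<forall>n\<ge>N. \<forall>H\<in>k_factors k n.
      bexp ((1 + e) / (real k * real n)) (all_edges n)
        (\<lambda>G. of_bool (real (card (k_factors_in k n (G \<union> H))) < exp (a * real n)))
      \<le> 2 * exp (- c * real n)"
proof -
  obtain \<delta> \<mu> c N where pos: "\<delta> > 0" "\<mu> > 0" "c > 0" and *: "\<forall>n\<ge>N. \<exists>m. \<mu> * real n \<le> real m \<and>
    (\<forall>H\<in>k_factors k n. \<forall>D. finite D \<and> real (card D) \<le> \<delta> * real n \<longrightarrow>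
      bexp ((1 + e) / (real k * real n)) (all_edges n)
        (\<lambda>G. of_bool (\<not> switchable k n H D m G)) \<le> 2 * exp (- c * real n))"
    using switchable_whp[OF assms] by blast
  obtain \<tau> where \<tau>: "\<tau> > 0" and few: "\<forall>V :: nat set. \<forall>n::nat. finite V \<and> real (card V) \<le> 1 * real n \<longrightarrow>
    real (card {A. A \<subseteq> V \<and> real (card A) \<le> \<tau> * real n}) \<le> exp (c / 2 * real n)"
    using few_small_subsets[of 1 "c / 2", where 'a = nat] pos by auto
  \<comment> \<open>The three bounds ensure, in order, that \<open>d\<close>-sets exist, that the
    failure bound applies to them, and that they are few.\<close>
  define \<eta> where "\<eta> = min 1 (min \<delta> \<tau>)"
  have \<eta>: "0 < \<eta>" "\<eta> \<le> 1" "\<eta> \<le> \<delta>" "\<eta> \<le> \<tau>" using pos \<tau> by (auto simp: \<eta>_def)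
  define a where "a = \<eta> * \<mu> / 2"
  have a: "a > 0" and c2: "c / 2 > 0" using \<eta> pos by (auto simp: a_def)
  define M where "M = max N (nat \<lceil>1 + 2 / \<eta>\<rceil>)"
  show ?thesis
  proof (rule exI[of _ a], rule conjI[OF a], rule exI[of _ "c / 2"], rule conjI[OF c2],
      rule exI[of _ M], intro allI impI ballI)
    fix n H assume "n \<ge> M" and H: "H \<in> k_factors k n"
    then have nN: "n \<ge> N" "real n \<ge> 1 + 2 / \<eta>" by (auto simp: M_def)
    have "2 / \<eta> > 0" using \<eta> by simp
    then have n: "n \<ge> 1" "real n \<ge> 2 / \<eta>" using nN(2) by linarith+
    define d where "d = nat \<lfloor>\<eta> * real n\<rfloor>"
    have "\<eta> * real n \<ge> 2" using n(2) \<eta> by (simp add: field_simps)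
    then have d: "\<eta> * real n / 2 \<le> real d" "real d \<le> \<eta> * real n"
      unfolding d_def by (rule nat_floor_ge_half)+
    have le: "\<eta> * real n \<le> 1 * real n" "\<eta> * real n \<le> \<delta> * real n" "\<eta> * real n \<le> \<tau> * real n"
      by (rule \<eta>(2-4)[THEN mult_right_mono[OF _ of_nat_0_le_iff]])+
    have dn: "d \<le> n" using d(2) le(1) by linarith
    obtain m where m: "\<mu> * real n \<le> real m" and fail: "\<And>D. finite D \<Longrightarrow> real (card D) \<le> \<delta> * real n \<Longrightarrow>
      bexp ((1 + e) / (real k * real n)) (all_edges n)
        (\<lambda>G. of_bool (\<not> switchable k n H D m G)) \<le> 2 * exp (- c * real n)"
      using *[rule_format, OF nN(1)] H by metis
    let ?p = "(1 + e) / (real k * real n)"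
    have p: "0 \<le> ?p" using e by simp
    have "1 * 2 \<le> real k * real n" using k n \<eta> \<open>\<eta> * real n \<ge> 2\<close> le(1) by (intro mult_mono) auto
    then have p1: "?p \<le> 1" using e by (simp add: divide_le_eq)
    define \<D> where "\<D> = {D. D \<subseteq> {..<n} \<and> card D = d}"
    have fin\<D>: "finite \<D>" by (simp add: \<D>_def)
    have ex: "exp (a * real n) \<le> exp (real d * real m / real n)"
    proof -
      have "\<eta> * real n / 2 * (\<mu> * real n) \<le> real d * real m"
        using d m pos \<eta> by (intro mult_mono) auto
      then show ?thesis using n(1) by (simp add: a_def field_simps)
    qed
    have "of_bool (real (card (k_factors_in k n (G \<union> H))) < exp (a * real n))
        \<le> (\<Sum>D\<in>\<D>. of_bool (\<not> switchable k n H D m G) :: real)" for G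
    proof (cases "\<forall>D\<in>\<D>. switchable k n H D m G")
      case True
      then have "exp (real d * real m / real n) \<le> real (card (k_factors_in k n (G \<union> H)))"
        by (intro card_k_factors_in_ge[OF H dn]) (auto simp: \<D>_def)
      then have "exp (a * real n) \<le> real (card (k_factors_in k n (G \<union> H)))"
        using ex by linarith
      then show ?thesis by (simp add: sum_nonneg)
    next
      case False
      then obtain D where "D \<in> \<D>" "\<not> switchable k n H D m G" by blast
      then have "1 \<le> (\<Sum>D\<in>\<D>. of_bool (\<not> switchable k n H D m G) :: real)"
        using member_le_sum[of D \<D> "\<lambda>D. of_bool (\<not> switchable k n H D m G) :: real"] fin\<D>
        by simp
      then show ?thesis by (simp add: of_bool_def)
    qed
    then have "bexp ?p (all_edges n)
        (\<lambda>G. of_bool (real (card (k_factors_in k n (G \<union> H))) < exp (a * real n)))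
      \<le> bexp ?p (all_edges n) (\<lambda>G. \<Sum>D\<in>\<D>. of_bool (\<not> switchable k n H D m G))"
      by (intro bexp_mono p p1)
    also have "\<dots> = (\<Sum>D\<in>\<D>. bexp ?p (all_edges n) (\<lambda>G. of_bool (\<not> switchable k n H D m G)))"
      by (rule bexp_sum)
    also have "\<dots> \<le> (\<Sum>D\<in>\<D>. 2 * exp (- c * real n))"
      using d le by (intro sum_mono fail) (auto simp: \<D>_def intro: finite_subset)
    also have "\<dots> = real (card \<D>) * (2 * exp (- c * real n))" by simp
    also have "\<dots> \<le> exp (c / 2 * real n) * (2 * exp (- c * real n))"
    proof (rule mult_right_mono)
      have "card \<D> \<le> card {A. A \<subseteq> {..<n} \<and> real (card A) \<le> \<tau> * real n}"
        using d le by (intro card_mono) (auto simp: \<D>_def)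
      moreover have "real (card {A. A \<subseteq> {..<n} \<and> real (card A) \<le> \<tau> * real n}) \<le> exp (c / 2 * real n)"
        using few by simp
      ultimately show "real (card \<D>) \<le> exp (c / 2 * real n)" by linarith
    qed simp
    also have "\<dots> = 2 * exp (- (c / 2) * real n)"
      by (simp add: exp_add[symmetric])
    finally show "bexp ?p (all_edges n)
        (\<lambda>G. of_bool (real (card (k_factors_in k n (G \<union> H))) < exp (a * real n)))
      \<le> 2 * exp (- (c / 2) * real n)" .
  qed
qed

section \<open>The posterior distribution of the planted k-factor\<close>

lemma card_k_factor:
  assumes H: "H \<in> k_factors k n"
  shows "2 * card H = k * n"
proof -
  have fin: "finite H" using k_factors_subset[OF H] by (rule finite_subset) simp
  have "card {v \<in> {..<n}. v \<in> e} = 2" if e: "e \<in> H" for e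
  proof -
    obtain u v where "u < n" "v < n" "u \<noteq> v" "e = {u, v}"
      using k_factors_subset[OF H] e by (auto simp: all_edges_def)
    then have "{x \<in> {..<n}. x \<in> e} = {u, v}" by auto
    then show ?thesis using \<open>u \<noteq> v\<close> by simp
  qed
  then have "(\<Sum>v<n. card {e \<in> H. v \<in> e}) = (\<Sum>e\<in>H. 2)"
    by (intro sum_multicount_gen fin) auto
  moreover have "(\<Sum>v<n. card {e \<in> H. v \<in> e}) = (\<Sum>v<n. k)"
    using H by (intro sum.cong) (auto simp: k_factors_def)
  ultimately show ?thesis by (simp add: mult.commute)
qed

text \<open>Pairs inside \<open>H\<close> belong to the union whether drawn or not, so only the
  randomness outside \<open>H\<close> remains.\<close>

lemma bexp_union_fixed:
  assumes E: "finite E" "H \<subseteq> E"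
  shows "bexp p E (\<lambda>G. f (G \<union> H))
    = (\<Sum>G\<in>{G. H \<subseteq> G \<and> G \<subseteq> E}. p ^ (card G - card H) * (1 - p) ^ (card E - card G) * f G)"
proof -
  have fin: "finite H" "finite (E - H)" using E by (auto intro: finite_subset)
  have "bexp p E (\<lambda>G. f (G \<union> H)) = bexp p (H \<union> (E - H)) (\<lambda>G. f (G \<union> H))"
    using E by (simp add: Un_absorb1)
  also have "\<dots> = bexp p H (\<lambda>G1. bexp p (E - H) (\<lambda>G2. f (G1 \<union> G2 \<union> H)))"
    using fin by (intro bexp_Un) auto
  also have "\<dots> = bexp p H (\<lambda>_. bexp p (E - H) (\<lambda>G2. f (G2 \<union> H)))"
    by (intro bexp_cong arg_cong[where f = f]) auto
  also have "\<dots> = bexp p (E - H) (\<lambda>G2. f (G2 \<union> H))"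
    by (rule bexp_const[OF fin(1)])
  also have "\<dots> = (\<Sum>G\<in>{G. H \<subseteq> G \<and> G \<subseteq> E}.
      p ^ (card G - card H) * (1 - p) ^ (card E - card G) * f G)"
    unfolding bexp_def
  proof (rule sum.reindex_bij_witness[where i = "\<lambda>G. G - H" and j = "\<lambda>G. G \<union> H"])
    fix G assume G: "G \<in> Pow (E - H)"
    then have "finite G" using fin by (auto intro: finite_subset)
    then have "card (G \<union> H) = card G + card H"
      using fin G by (intro card_Un_disjoint) auto
    moreover have "card (E - H) = card E - card H"
      using E fin by (simp add: card_Diff_subset)
    ultimately show "p ^ (card (G \<union> H) - card H) * (1 - p) ^ (card E - card (G \<union> H)) * f (G \<union> H)
        = p ^ card G * (1 - p) ^ (card (E - H) - card G) * f (G \<union> H)"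
      by (simp add: add.commute)
  qed (use E in auto)
  finally show ?thesis .
qed

text \<open>All k-factors have the same size, so the joint probability of \<open>(H, G)\<close> depends on \<open>G\<close> only
  as long as \<open>H \<subseteq> G\<close>.\<close>
lemma planted_joint:
  fixes M :: "nat set set \<Rightarrow> nat set set set"
  assumes M: "\<And>G. G \<subseteq> all_edges n \<Longrightarrow> M G \<subseteq> k_factors_in k n G"
  shows "(\<Sum>H\<in>k_factors k n. bexp p (all_edges n) (\<lambda>G. of_bool (H \<in> M (G \<union> H))))
    = (\<Sum>G\<in>Pow (all_edges n). p ^ (card G - k * n div 2)
        * (1 - p) ^ (card (all_edges n) - card G) * real (card (M G)))"
proof -
  let ?E = "all_edges n"
  let ?\<phi> = "\<lambda>G. p ^ (card G - k * n div 2) * (1 - p) ^ (card ?E - card G)"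
  have "bexp p ?E (\<lambda>G. of_bool (H \<in> M (G \<union> H))) = (\<Sum>G\<in>Pow ?E. ?\<phi> G * of_bool (H \<in> M G))"
    if H: "H \<in> k_factors k n" for H
  proof -
    have "card H = k * n div 2" using card_k_factor[OF H] by linarith
    then have "bexp p ?E (\<lambda>G. of_bool (H \<in> M (G \<union> H)))
        = (\<Sum>G\<in>{G. H \<subseteq> G \<and> G \<subseteq> ?E}. ?\<phi> G * of_bool (H \<in> M G))"
      using bexp_union_fixed[OF finite_all_edges k_factors_subset[OF H],
          of p "\<lambda>G. of_bool (H \<in> M G)"] by simp
    also have "\<dots> = (\<Sum>G\<in>Pow ?E. ?\<phi> G * of_bool (H \<in> M G))"
      using M by (intro sum.mono_neutral_left) (auto simp: k_factors_in_def)
    finally show ?thesis .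
  qed
  then have "(\<Sum>H\<in>k_factors k n. bexp p ?E (\<lambda>G. of_bool (H \<in> M (G \<union> H))))
      = (\<Sum>H\<in>k_factors k n. \<Sum>G\<in>Pow ?E. ?\<phi> G * of_bool (H \<in> M G))"
    by (rule sum.cong[OF refl])
  also have "\<dots> = (\<Sum>G\<in>Pow ?E. \<Sum>H\<in>k_factors k n. ?\<phi> G * of_bool (H \<in> M G))"
    by (rule sum.swap)
  also have "\<dots> = (\<Sum>G\<in>Pow ?E. ?\<phi> G * real (card (M G)))"
  proof (rule sum.cong[OF refl])
    fix G assume "G \<in> Pow ?E"
    then have "M G \<subseteq> k_factors k n" using M[of G] by (auto simp: k_factors_in_def)
    then have "(\<Sum>H\<in>k_factors k n. of_bool (H \<in> M G) :: real) = real (card (M G))"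
      by (simp add: sum.inter_filter[symmetric] of_bool_def Int_absorb1 flip: Int_def)
    then show "(\<Sum>H\<in>k_factors k n. ?\<phi> G * of_bool (H \<in> M G)) = ?\<phi> G * real (card (M G))"
      by (simp only: sum_distrib_left[symmetric])
  qed
  finally show ?thesis .
qed

text \<open>Given \<open>G\<close>, the planted k-factor is uniform on
  \<open>k_factors_in k n G\<close>, so a fraction bound for every \<open>G\<close> bounds the
  probability. The normalisation is the same joint sum with \<open>M\<close> equal to all of
  \<open>k_factors_in\<close>.\<close>

lemma posterior_bound:
  fixes M :: "nat set set \<Rightarrow> nat set set set"
  assumes p: "0 \<le> p" "p \<le> 1"
    and M: "\<And>G. G \<subseteq> all_edges n \<Longrightarrow> M G \<subseteq> k_factors_in k n G"
    and \<beta>: "\<And>G. G \<subseteq> all_edges n \<Longrightarrow> real (card (M G)) \<le> \<beta> * real (card (k_factors_in k n G))"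
  shows "(\<Sum>H\<in>k_factors k n. bexp p (all_edges n) (\<lambda>G. of_bool (H \<in> M (G \<union> H))))
    \<le> \<beta> * real (card (k_factors k n))"
proof -
  let ?\<phi> = "\<lambda>G. p ^ (card G - k * n div 2) * (1 - p) ^ (card (all_edges n) - card G)"
  have "(\<Sum>H\<in>k_factors k n. bexp p (all_edges n) (\<lambda>G. of_bool (H \<in> M (G \<union> H))))
      = (\<Sum>G\<in>Pow (all_edges n). ?\<phi> G * real (card (M G)))"
    by (rule planted_joint[OF M])
  also have "\<dots> \<le> (\<Sum>G\<in>Pow (all_edges n). ?\<phi> G * (\<beta> * real (card (k_factors_in k n G))))"
    using p \<beta> by (intro sum_mono mult_left_mono) auto
  also have "\<dots> = \<beta> * (\<Sum>G\<in>Pow (all_edges n). ?\<phi> G * real (card (k_factors_in k n G)))"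
    by (simp add: sum_distrib_left mult_ac)
  also have "(\<Sum>G\<in>Pow (all_edges n). ?\<phi> G * real (card (k_factors_in k n G)))
      = (\<Sum>H\<in>k_factors k n. bexp p (all_edges n) (\<lambda>G. of_bool (H \<in> k_factors_in k n (G \<union> H))))"
    by (rule planted_joint[symmetric]) simp
  also have "\<dots> = real (card (k_factors k n))"
    by (simp add: k_factors_in_def bexp_const)
  finally show ?thesis .
qed

section \<open>From the posterior to the failure of recovery\<close>

text \<open>As \<open>H\<close> has at most \<open>k * n\<close> edges, the noise must exceed
  \<open>5 * n\<close>, while its exponential moment is at most \<open>exp (4 * n)\<close>. A linear
  edge count is what makes small subsets of \<open>G\<close> few.\<close>

lemma edge_count_tail:
  assumes H: "H \<in> k_factors k n" and p: "0 \<le> p" "p \<le> 1" "p * real n \<le> 2"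
  shows "bexp p (all_edges n) (\<lambda>G. of_bool (real (card (G \<union> H)) > (real k + 5) * real n))
    \<le> exp (- real n)"
proof -
  have "bexp p (all_edges n) (\<lambda>G. of_bool (real (card (G \<union> H)) > (real k + 5) * real n))
      \<le> bexp p (all_edges n) (\<lambda>G. exp (- (5 * real n)) * exp 1 ^ card G)"
  proof (rule bexp_mono[OF p(1,2)])
    fix G :: "nat set set"
    have "card (G \<union> H) \<le> card G + card H" by (rule card_Un_le)
    also have "card H \<le> k * n" using card_k_factor[OF H] by linarith
    finally have "real (card (G \<union> H)) \<le> real (card G) + real k * real n"
      unfolding of_nat_mult[symmetric] of_nat_add[symmetric] by (simp only: of_nat_le_iff)
    moreover have "exp (- (5 * real n)) * exp 1 ^ card G = exp (real (card G) - 5 * real n)"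
      by (simp add: exp_of_nat_mult[symmetric] exp_add[symmetric])
    ultimately show "of_bool (real (card (G \<union> H)) > (real k + 5) * real n)
        \<le> exp (- (5 * real n)) * exp 1 ^ card G"
      by (auto simp: algebra_simps)
  qed
  also have "\<dots> = exp (- (5 * real n)) * (1 - p + p * exp 1) ^ card (all_edges n)"
    by (simp add: bexp_cmult bexp_power)
  also have "\<dots> \<le> exp (- (5 * real n)) * exp (4 * real n)"
  proof (rule mult_left_mono)
    have e: "1 \<le> exp (1::real)" by simp
    have pe: "p * 1 \<le> p * exp 1" using p e by (intro mult_left_mono) auto
    have "(1 - p + p * exp 1) ^ card (all_edges n) \<le> exp (p * (exp 1 - 1)) ^ card (all_edges n)"
      using exp_ge_add_one_self[of "p * (exp 1 - 1)"] pe p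
      by (intro power_mono) (auto simp: algebra_simps)
    also have "\<dots> = exp (real (card (all_edges n)) * (p * (exp 1 - 1)))"
      by (simp add: exp_of_nat_mult)
    also have "real (card (all_edges n)) * (p * (exp 1 - 1)) \<le> (real n * real n) * (p * 2)"
    proof (rule mult_mono)
      show "real (card (all_edges n)) \<le> real n * real n"
        using card_all_edges_le[of n] unfolding of_nat_mult[symmetric] by (simp only: of_nat_le_iff)
      show "p * (exp 1 - 1) \<le> p * 2" using exp_le p by (intro mult_left_mono) auto
    qed (use p e in auto)
    also have "\<dots> = p * real n * (2 * real n)" by simp
    also have "\<dots> \<le> 2 * (2 * real n)" using p by (intro mult_right_mono) auto
    finally show "(1 - p + p * exp 1) ^ card (all_edges n) \<le> exp (4 * real n)" by simp
  qed simp
  also have "\<dots> = exp (- real n)" by (simp add: exp_add[symmetric])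
  finally show ?thesis .
qed

text \<open>Two k-factors near \<open>est\<close> differ by at most \<open>t * k * n\<close> edges,
  by the triangle inequality. Taking the symmetric difference with a fixed one of them is
  injective.\<close>

lemma card_near_le:
  assumes G: "finite G" and est: "finite (est :: nat set set)"
    and N: "N \<subseteq> k_factors_in k n G" "\<And>H. H \<in> N \<Longrightarrow> loss H est < t"
    and k: "k \<ge> 1" and n: "n \<ge> 1" and t: "t * real k \<le> \<tau>"
  shows "card N \<le> card {A. A \<subseteq> G \<and> real (card A) \<le> \<tau> * real n}"
proof (cases "N = {}")
  case False
  then obtain H1 where H1: "H1 \<in> N" by blast
  have fin: "finite H" "H \<subseteq> G" if "H \<in> N" for H
    using that N(1) G by (auto simp: k_factors_in_def intro: finite_subset)
  have near: "2 * real (card (sym_diff H est)) < t * real k * real n" if H: "H \<in> N" for H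
  proof -
    have "2 * card H = k * n" using card_k_factor[of H k n] H N(1) by (auto simp: k_factors_in_def)
    then have c: "2 * real (card H) = real k * real n"
      unfolding of_nat_mult[symmetric] by linarith
    then have "0 < real (card H)" using k n
      by (metis mult_pos_pos of_nat_0_less_iff less_le_trans zero_less_one
          zero_less_mult_pos zero_less_numeral)
    then have "real (card (sym_diff H est)) < t * real (card H)"
      using N(2)[OF H] by (simp add: loss_def divide_less_eq)
    moreover have "t * real k * real n = 2 * (t * real (card H))"
      unfolding mult.assoc c[symmetric] by simp
    ultimately show ?thesis by linarith
  qed
  have "inj_on (\<lambda>H. sym_diff H H1) N"
    by (rule inj_onI) blast
  moreover have "(\<lambda>H. sym_diff H H1) ` N \<subseteq> {A. A \<subseteq> G \<and> real (card A) \<le> \<tau> * real n}"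
  proof clarify
    fix H assume H: "H \<in> N"
    have "card (sym_diff H H1) \<le> card (sym_diff H est \<union> sym_diff H1 est)"
      using fin[OF H] fin[OF H1] est by (intro card_mono) auto
    also have "\<dots> \<le> card (sym_diff H est) + card (sym_diff H1 est)" by (rule card_Un_le)
    finally have "real (card (sym_diff H H1)) \<le> t * real k * real n"
      using near[OF H] near[OF H1] by linarith
    also have "\<dots> \<le> \<tau> * real n" using t by (rule mult_right_mono) simp
    finally show "sym_diff H H1 \<subseteq> G \<and> real (card (sym_diff H H1)) \<le> \<tau> * real n"
      using fin[OF H] fin[OF H1] by auto
  qed
  moreover have "finite {A. A \<subseteq> G \<and> real (card A) \<le> \<tau> * real n}" using G by simp
  ultimately show ?thesis by (rule card_inj_on_le)
qed simp

text \<open>Success needs too few k-factors in \<open>G\<close>, too many edges in \<open>G\<close>,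
  or a planted k-factor among the few near the estimate; the last are a fraction at most
  \<open>exp (- (a / 2) * n)\<close> of the k-factors of \<open>G\<close>.\<close>

lemma recovery_unlikely:
  fixes e :: real
  assumes k: "k \<ge> 1" and e: "0 < e" "e \<le> 1"
  shows "\<exists>t>0. \<exists>c>0. \<exists>N. \<forall>n\<ge>N. \<forall>est. (\<forall>G. finite (est G)) \<longrightarrow>
    (\<Sum>H\<in>k_factors k n. bexp ((1 + e) / (real k * real n)) (all_edges n)
        (\<lambda>G. of_bool (loss H (est (G \<union> H)) < t)))
      \<le> exp (- c * real n) * real (card (k_factors k n))"
proof -
  obtain a c N where a: "a > 0" and c: "c > 0" and many: "\<forall>n\<ge>N. \<forall>H\<in>k_factors k n.
      bexp ((1 + e) / (real k * real n)) (all_edges n)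
        (\<lambda>G. of_bool (real (card (k_factors_in k n (G \<union> H))) < exp (a * real n)))
      \<le> 2 * exp (- c * real n)"
    using many_k_factors[OF assms] by blast
  obtain \<tau> where \<tau>: "\<tau> > 0" and few: "\<forall>G :: nat set set. \<forall>n::nat.
      finite G \<and> real (card G) \<le> (real k + 5) * real n \<longrightarrow>
      real (card {A. A \<subseteq> G \<and> real (card A) \<le> \<tau> * real n}) \<le> exp (a / 2 * real n)"
    using few_small_subsets[of "real k + 5" "a / 2", where 'a = "nat set"] a by auto
  define t where "t = \<tau> / real k"
  have t: "t > 0" "t * real k \<le> \<tau>" using \<tau> k by (auto simp: t_def)
  \<comment> \<open>Half of the smallest rate is kept; the other half absorbs the constant 4, since
    \<open>n \<ge> 3 / b\<close> gives \<open>exp (b * n) \<ge> 4\<close>.\<close>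
  define b where "b = min (min (a / 2) c) 1 / 2"
  have b: "b > 0" using a c by (simp add: b_def)
  define M where "M = max (max N 2) (nat \<lceil>3 / b\<rceil>)"
  show ?thesis
  proof (rule exI[of _ t], rule conjI[OF t(1)], rule exI[of _ b], rule conjI[OF b],
      rule exI[of _ M], intro allI impI)
    fix n and est :: "nat set set \<Rightarrow> nat set set"
    assume "n \<ge> M" and est: "\<forall>G. finite (est G)"
    then have n: "n \<ge> N" "n \<ge> 2" "real n \<ge> 3 / b" by (auto simp: M_def)
    let ?p = "(1 + e) / (real k * real n)"
    let ?E = "all_edges n"
    have "1 * 2 \<le> real k * real n" using k n by (intro mult_mono) auto
    then have p: "0 \<le> ?p" "?p \<le> 1" using e by (auto simp: divide_le_eq)
    have "?p * real n = (1 + e) / real k" using n(2) by simp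
    also have "\<dots> \<le> 2 / 1" using k e by (intro frac_le) auto
    finally have pn: "?p * real n \<le> 2" by simp
    \<comment> \<open>The candidate set is empty for atypical \<open>G\<close>, so the fraction
      bound holds for every \<open>G\<close>.\<close>
    define Q where "Q G = {H \<in> k_factors_in k n G. loss H (est G) < t
      \<and> exp (a * real n) \<le> real (card (k_factors_in k n G))
      \<and> real (card G) \<le> (real k + 5) * real n}" for G
    have Q: "Q G \<subseteq> k_factors_in k n G" for G by (auto simp: Q_def)
    have cardQ: "real (card (Q G)) \<le> exp (- (a / 2) * real n) * real (card (k_factors_in k n G))"
      if "G \<subseteq> ?E" for G
    proof (cases "Q G = {}")
      case False
      have G: "finite G" using that by (rule finite_subset) simp
      from False have 1: "exp (a * real n) \<le> real (card (k_factors_in k n G))"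
        and 2: "real (card G) \<le> (real k + 5) * real n" by (auto simp: Q_def)
      have "real (card (Q G)) \<le> real (card {A. A \<subseteq> G \<and> real (card A) \<le> \<tau> * real n})"
        using card_near_le[OF G _ Q _ k _ t(2), of "est G"] est n(2) by (auto simp: Q_def)
      also have "\<dots> \<le> exp (a / 2 * real n)" using few G 2 by blast
      also have "\<dots> = exp (- (a / 2) * real n) * exp (a * real n)"
        by (simp add: exp_add[symmetric])
      also have "\<dots> \<le> exp (- (a / 2) * real n) * real (card (k_factors_in k n G))"
        using 1 by (intro mult_left_mono) auto
      finally show ?thesis .
    qed simp
    have main: "(\<Sum>H\<in>k_factors k n. bexp ?p ?E (\<lambda>G. of_bool (H \<in> Q (G \<union> H))))
        \<le> exp (- (a / 2) * real n) * real (card (k_factors k n))"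
      by (rule posterior_bound[OF p Q cardQ])
    have split: "bexp ?p ?E (\<lambda>G. of_bool (loss H (est (G \<union> H)) < t))
        \<le> bexp ?p ?E (\<lambda>G. of_bool (H \<in> Q (G \<union> H))) + 2 * exp (- c * real n) + exp (- real n)"
      if H: "H \<in> k_factors k n" for H
    proof -
      have "bexp ?p ?E (\<lambda>G. of_bool (loss H (est (G \<union> H)) < t))
        \<le> bexp ?p ?E (\<lambda>G. of_bool (H \<in> Q (G \<union> H))
            + of_bool (real (card (k_factors_in k n (G \<union> H))) < exp (a * real n))
            + of_bool (real (card (G \<union> H)) > (real k + 5) * real n))"
        using H by (intro bexp_mono[OF p]) (auto simp: Q_def k_factors_in_def)
      also have "\<dots> \<le> bexp ?p ?E (\<lambda>G. of_bool (H \<in> Q (G \<union> H))) + 2 * exp (- c * real n)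
          + exp (- real n)"
        unfolding bexp_add using many n(1) H edge_count_tail[OF H p pn]
        by (intro add_mono) auto
      finally show ?thesis .
    qed
    have "(\<Sum>H\<in>k_factors k n. bexp ?p ?E (\<lambda>G. of_bool (loss H (est (G \<union> H)) < t)))
        \<le> (\<Sum>H\<in>k_factors k n. bexp ?p ?E (\<lambda>G. of_bool (H \<in> Q (G \<union> H)))
              + 2 * exp (- c * real n) + exp (- real n))"
      by (rule sum_mono[OF split])
    also have "\<dots> \<le> (exp (- (a / 2) * real n) + 2 * exp (- c * real n) + exp (- real n))
        * real (card (k_factors k n))"
      using main by (simp add: sum.distrib algebra_simps)
    also have "\<dots> \<le> exp (- b * real n) * real (card (k_factors k n))"
    proof (rule mult_right_mono)
      have le: "exp (- s * real n) \<le> exp (- (2 * b) * real n)" if "2 * b \<le> s" for s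
        using mult_right_mono[OF that, of "real n"] by simp
      have "2 * b \<le> a / 2" "2 * b \<le> c" "2 * b \<le> 1" by (auto simp: b_def)
      then have "exp (- (a / 2) * real n) \<le> exp (- (2 * b) * real n)"
        "exp (- c * real n) \<le> exp (- (2 * b) * real n)" "exp (- real n) \<le> exp (- (2 * b) * real n)"
        using le[of "a / 2"] le[of c] le[of 1] by simp_all
      then have "exp (- (a / 2) * real n) + 2 * exp (- c * real n) + exp (- real n)
          \<le> 4 * exp (- (2 * b) * real n)"
        by linarith
      also have "4 \<le> exp (b * real n)"
      proof -
        have "3 \<le> b * real n" using n(3) b by (simp add: field_simps)
        then show ?thesis using exp_ge_add_one_self[of "b * real n"] by linarith
      qed
      then have "4 * exp (- (2 * b) * real n) \<le> exp (b * real n) * exp (- (2 * b) * real n)"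
        by (rule mult_right_mono) simp
      also have "\<dots> = exp (- b * real n)" by (simp add: exp_add[symmetric])
      finally show "exp (- (a / 2) * real n) + 2 * exp (- c * real n) + exp (- real n)
          \<le> exp (- b * real n)" .
    qed simp
    finally show "(\<Sum>H\<in>k_factors k n. bexp ?p ?E (\<lambda>G. of_bool (loss H (est (G \<union> H)) < t)))
        \<le> exp (- b * real n) * real (card (k_factors k n))" .
  qed
qed

section \<open>Existence of k-factors\<close>

text \<open>The circulant graph with step set \<open>S\<close>. An edge that arrives at
  \<open>v\<close> by the step \<open>t\<close> leaves \<open>v\<close> by the step
  \<open>n - t\<close>, so the edges at \<open>v\<close> are indexed by \<open>S\<close>.\<close>

lemma circulant_k_factor:
  assumes S: "S \<subseteq> {1..<n}" and sym: "\<And>s. s \<in> S \<Longrightarrow> n - s \<in> S"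
  shows "(\<lambda>(v, s). {v, (v + s) mod n}) ` ({..<n} \<times> S) \<in> k_factors (card S) n"
proof -
  let ?H = "(\<lambda>(v, s). {v, (v + s) mod n}) ` ({..<n} \<times> S)"
  have shift: "(v + s) mod n = (if v + s < n then v + s else v + s - n)" if "v < n" "s \<in> S" for v s
    using that S by (auto simp: le_mod_geq)
  have s: "1 \<le> s" "s < n" if "s \<in> S" for s using that S by auto
  have ne: "(v + s) mod n \<noteq> v" "(v + s) mod n < n" if "v < n" "s \<in> S" for v s
    using shift[OF that] s[OF that(2)] that(1) by auto
  have "?H \<subseteq> all_edges n"
  proof
    fix x assume "x \<in> ?H"
    then obtain v s where "v < n" "s \<in> S" "x = {v, (v + s) mod n}" by auto
    then show "x \<in> all_edges n"
      using ne[of v s] by (simp add: all_edges_iff)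
  qed
  moreover have "card {e \<in> ?H. v \<in> e} = card S" if v: "v < n" for v
  proof -
    have "{e \<in> ?H. v \<in> e} = (\<lambda>s. {v, (v + s) mod n}) ` S"
    proof (intro equalityI subsetI)
      fix e assume "e \<in> {e \<in> ?H. v \<in> e}"
      then obtain u t where ut: "u < n" "t \<in> S" "e = {u, (u + t) mod n}" "v \<in> e" by auto
      show "e \<in> (\<lambda>s. {v, (v + s) mod n}) ` S"
      proof (cases "v = u")
        case True
        then show ?thesis using ut by auto
      next
        case False
        then have "v = (u + t) mod n" using ut by auto
        then have "(v + (n - t)) mod n = u"
          using shift[OF ut(1,2)] shift[OF v sym[OF ut(2)]] s[OF ut(2)] ut(1) by (auto split: if_splits)
        then have "e = {v, (v + (n - t)) mod n}" using ut \<open>v = _\<close> by auto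
        then show ?thesis using sym[OF ut(2)] by auto
      qed
    qed (use v in auto)
    moreover have "inj_on (\<lambda>s. {v, (v + s) mod n}) S"
    proof (rule inj_onI)
      fix s t assume st: "s \<in> S" "t \<in> S" and eq: "{v, (v + s) mod n} = {v, (v + t) mod n}"
      then have "(v + s) mod n = (v + t) mod n" by (auto simp: doubleton_eq_iff)
      then show "s = t"
        using shift[OF v st(1)] shift[OF v st(2)] s[OF st(1)] s[OF st(2)] v
        by (auto split: if_splits)
    qed
    ultimately show ?thesis by (simp add: card_image)
  qed
  ultimately show ?thesis by (simp add: k_factors_def)
qed

text \<open>Take the \<open>k div 2\<close> shortest steps in both directions, and for odd
  \<open>k\<close>, where \<open>n\<close> must be even, also the antipodal step
  \<open>n div 2\<close>. Nonemptiness makes the average over k-factors a true mean.\<close>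

lemma k_factors_nonempty:
  assumes "even (k * n)" "k < n"
  shows "k_factors k n \<noteq> {}"
proof -
  define j where "j = k div 2"
  define S where "S = {1..j} \<union> {n - j..<n} \<union> (if odd k then {n div 2} else {})"
  have jn: "2 * j < n" using assms(2) by (auto simp: j_def)
  have odd: "2 * (n div 2) = n \<and> j < n div 2 \<and> n div 2 < n - j" if "odd k"
    using that assms by (auto simp: j_def elim!: oddE)
  have "S \<subseteq> {1..<n}" using jn odd by (auto simp: S_def)
  moreover have "n - s \<in> S" if "s \<in> S" for s
    using that jn odd by (auto simp: S_def split: if_splits)
  moreover have "card S = k"
  proof -
    have "card ({1..j} \<union> {n - j..<n}) = j + j"
      using jn by (subst card_Un_disjoint) auto
    moreover have "card ({1..j} \<union> {n - j..<n} \<union> {n div 2}) = card ({1..j} \<union> {n - j..<n}) + 1"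
      if "odd k"
      using odd[OF that] by (subst card_Un_disjoint) auto
    ultimately show ?thesis
      by (cases "even k") (auto simp: S_def j_def elim!: evenE oddE)
  qed
  ultimately show ?thesis using circulant_k_factor[of S n] by auto
qed

section \<open>The planted model\<close>

lemma planted_expect_bexp:
  "planted_expect k n p f
    = (\<Sum>H\<in>k_factors k n. bexp p (all_edges n) (\<lambda>G. f H (G \<union> H))) / real (card (k_factors k n))"
  by (simp add: planted_expect_def bexp_def gnp_prob_def)

text \<open>The surplus noise between the densities \<open>p\<^sub>0\<close> and \<open>p\<close> can be generated by the estimator
  itself.\<close>
lemma recovery_monotone:
  fixes p\<^sub>0 p \<beta> :: real
  assumes p: "0 \<le> p\<^sub>0" "p\<^sub>0 < 1" "p\<^sub>0 \<le> p" "p \<le> 1" and est: "\<forall>G. finite (est G)"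
    and base: "\<And>est. \<forall>G. finite (est G) \<Longrightarrow> (\<Sum>H\<in>k_factors k n. bexp p\<^sub>0 (all_edges n)
        (\<lambda>G. of_bool (loss H (est (G \<union> H)) < t))) \<le> \<beta>"
  shows "(\<Sum>H\<in>k_factors k n. bexp p (all_edges n)
        (\<lambda>G. of_bool (loss H (est (G \<union> H)) < t))) \<le> \<beta>"
proof -
  \<comment> \<open>The density of independent extra noise that raises \<open>p\<^sub>0\<close> to
    \<open>p\<close>.\<close>
  define q where "q = (p - p\<^sub>0) / (1 - p\<^sub>0)"
  have q: "0 \<le> q" "q \<le> 1" using p by (auto simp: q_def divide_le_eq)
  have "q * (1 - p\<^sub>0) = p - p\<^sub>0" using p by (simp add: q_def)
  then have pq: "p = p\<^sub>0 + q - p\<^sub>0 * q" by (simp add: algebra_simps)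
  have "(\<Sum>H\<in>k_factors k n. bexp p (all_edges n) (\<lambda>G. of_bool (loss H (est (G \<union> H)) < t)))
      = (\<Sum>H\<in>k_factors k n. bexp q (all_edges n) (\<lambda>G2. bexp p\<^sub>0 (all_edges n)
          (\<lambda>G1. of_bool (loss H (est (G1 \<union> H \<union> G2)) < t))))"
    unfolding pq bexp_union_independent[OF finite_all_edges] by (simp add: Un_ac)
  also have "\<dots> = bexp q (all_edges n) (\<lambda>G2. \<Sum>H\<in>k_factors k n. bexp p\<^sub>0 (all_edges n)
          (\<lambda>G1. of_bool (loss H (est (G1 \<union> H \<union> G2)) < t)))"
    by (rule bexp_sum[symmetric])
  \<comment> \<open>For each fixed extra noise \<open>G2\<close>, the map from \<open>G\<close> to
    \<open>est (G \<union> G2)\<close> is an estimator at density \<open>p\<^sub>0\<close>.\<close>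
  also have "\<dots> \<le> bexp q (all_edges n) (\<lambda>_. \<beta>)"
    using est by (intro bexp_mono[OF q] base[of "\<lambda>G. est (G \<union> _)"]) auto
  also have "\<dots> = \<beta>" by (simp add: bexp_const)
  finally show ?thesis .
qed

theorem mainTheorem4:
  fixes k :: nat and eps :: real
  assumes "k \<ge> 1" and "eps > 0"
  shows "\<exists>eps' > 0. \<exists>c > 0. \<exists>N. \<forall>n \<ge> N. \<forall>lam :: real. \<forall>est :: nat set set \<Rightarrow> nat set set.
           (even (k * n) \<and> lam * real k \<ge> 1 + eps \<and> lam / real n \<le> 1
             \<and> (\<forall>G. est G \<subseteq> all_edges n)) \<longrightarrow>
           (prob_loss_ge k n (lam / real n) est eps' \<ge> 1 - exp (- c * real n)
            \<and> expected_loss k n (lam / real n) est \<ge> eps' / 2)"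
proof -
  \<comment> \<open>Capping at 1 meets the range of the exploration estimates; denser noise is
    handled by monotonicity.\<close>
  define e where "e = min eps 1"
  have e: "0 < e" "e \<le> 1" "e \<le> eps" using assms(2) by (auto simp: e_def)
  obtain t c N where t: "t > 0" and c: "c > 0" and rec: "\<forall>n\<ge>N. \<forall>est. (\<forall>G. finite (est G)) \<longrightarrow>
    (\<Sum>H\<in>k_factors k n. bexp ((1 + e) / (real k * real n)) (all_edges n)
        (\<lambda>G. of_bool (loss H (est (G \<union> H)) < t)))
      \<le> exp (- c * real n) * real (card (k_factors k n))"
    using recovery_unlikely[OF assms(1) e(1,2)] by blast
  \<comment> \<open>The bound \<open>k + 3\<close> yields a k-factor and a base density below 1;
    \<open>1 / c\<close> makes the failure probability at most one half.\<close>
  define M where "M = max (max N (k + 3)) (nat \<lceil>1 / c\<rceil>)"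
  show ?thesis
  proof (rule exI[of _ t], rule conjI[OF t], rule exI[of _ c], rule conjI[OF c],
      rule exI[of _ M], intro allI impI)
    fix n :: nat and lam :: real and est :: "nat set set \<Rightarrow> nat set set"
    assume "n \<ge> M" and A: "even (k * n) \<and> lam * real k \<ge> 1 + eps \<and> lam / real n \<le> 1
             \<and> (\<forall>G. est G \<subseteq> all_edges n)"
    then have n: "n \<ge> N" "n \<ge> k + 3" "real n \<ge> 1 / c" by (auto simp: M_def)
    let ?p = "lam / real n" and ?r = "(1 + e) / (real k * real n)" and ?E = "all_edges n"
    let ?F = "k_factors k n"
    have fin: "\<forall>G. finite (est G)" using A by (meson finite_all_edges finite_subset)
    have ne: "?F \<noteq> {}" using k_factors_nonempty[of k n] A n(2) by simp
    then have K: "real (card ?F) > 0" by (simp add: card_gt_0_iff)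
    have "1 * 3 \<le> real k * real n" using assms(1) n(2) by (intro mult_mono) auto
    then have p0: "0 \<le> ?r" "?r < 1" using e by (auto simp: divide_less_eq)
    have "(1 + e) / real k \<le> lam" using A e(3) assms(1) by (simp add: divide_le_eq)
    then have "(1 + e) / real k / real n \<le> ?p" by (rule divide_right_mono) simp
    then have p0p: "?r \<le> ?p" by simp
    have p: "0 \<le> ?p" "?p \<le> 1" using p0 p0p A by linarith+
    have fail: "(\<Sum>H\<in>?F. bexp ?p ?E (\<lambda>G. of_bool (loss H (est (G \<union> H)) < t)))
        \<le> exp (- c * real n) * real (card ?F)"
      using rec n(1) by (intro recovery_monotone[OF p0 p0p p(2) fin]) blast
    have compl: "bexp ?p ?E (\<lambda>G. if loss H (est (G \<union> H)) \<ge> t then 1 else 0)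
        = 1 - bexp ?p ?E (\<lambda>G. of_bool (loss H (est (G \<union> H)) < t))" for H
    proof -
      have "bexp ?p ?E (\<lambda>G. if loss H (est (G \<union> H)) \<ge> t then 1 else 0)
          + bexp ?p ?E (\<lambda>G. of_bool (loss H (est (G \<union> H)) < t)) = bexp ?p ?E (\<lambda>_. 1)"
        unfolding bexp_add[symmetric] by (rule bexp_cong) auto
      then show ?thesis by (simp add: bexp_const)
    qed
    have "prob_loss_ge k n ?p est t
        = (\<Sum>H\<in>?F. 1 - bexp ?p ?E (\<lambda>G. of_bool (loss H (est (G \<union> H)) < t))) / real (card ?F)"
      unfolding prob_loss_ge_def planted_expect_bexp compl ..
    also have "\<dots> = 1 - (\<Sum>H\<in>?F. bexp ?p ?E (\<lambda>G. of_bool (loss H (est (G \<union> H)) < t)))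
        / real (card ?F)"
      using ne by (simp add: sum_subtractf diff_divide_distrib)
    also have "\<dots> \<ge> 1 - exp (- c * real n)"
      using fail unfolding pos_divide_le_eq[OF K, symmetric] by simp
    finally have P: "prob_loss_ge k n ?p est t \<ge> 1 - exp (- c * real n)" .
    \<comment> \<open>Markov's inequality: \<open>t\<close> times the indicator of a loss of at
      least \<open>t\<close> never exceeds the loss.\<close>
    have "t * prob_loss_ge k n ?p est t = (\<Sum>H\<in>?F. bexp ?p ?E
        (\<lambda>G. t * (if loss H (est (G \<union> H)) \<ge> t then 1 else 0))) / real (card ?F)"
      unfolding prob_loss_ge_def planted_expect_bexp bexp_cmult by (simp add: sum_distrib_left)
    also have "\<dots> \<le> expected_loss k n ?p est"
      unfolding expected_loss_def planted_expect_bexp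
      by (intro divide_right_mono sum_mono bexp_mono[OF p]) (auto simp: loss_def)
    finally have L: "t * prob_loss_ge k n ?p est t \<le> expected_loss k n ?p est" .
    have "1 / 2 \<le> prob_loss_ge k n ?p est t"
    proof -
      have "1 \<le> c * real n" using n(3) c by (simp add: field_simps)
      then have "2 \<le> exp (c * real n)" using exp_ge_add_one_self[of "c * real n"] by linarith
      then have "exp (- c * real n) \<le> 1 / 2" by (simp add: exp_minus field_simps)
      then show ?thesis using P by linarith
    qed
    then have "t * (1 / 2) \<le> t * prob_loss_ge k n ?p est t" using t by (intro mult_left_mono) auto
    then show "prob_loss_ge k n ?p est t \<ge> 1 - exp (- c * real n)
        \<and> expected_loss k n ?p est \<ge> t / 2"
      using P L by simp
  qed
qed

end
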